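(* Let $\omega=(q_n)_{n=1}^\infty$ be a sequence of real numbers with $0<q_n<1$ for every $n$. If $\omega$ does not have an upper bound, i.e. there is no $\delta>0$ such that $q_n\le 1-\delta$ for all $n\in\mathbb N$, then $X_{E(\omega)}=\widehat{\mathbb C}\setminus E(\omega)$ is not quasiconformally equivalent to $X_{\mathcal C}=\widehat{\mathbb C}\setminus\mathcal C$, where $\mathcal C\subset[0,1]$ is the standard middle one-third Cantor set.
   Context: Random Cantor set $E(\omega)$: for a sequence $\omega=(q_n)_{n\ge1}$ with $0<q_n<1$, put $E_0=[0,1]$. Inductively, $E_k$ is a disjoint union of $2^k$ closed intervals of equal length, and $E_{k+1}$ is obtained from $E_k$ by removing from each of these closed intervals $I$ the concentric open interval of length $q_{k+1}|I|$, where $|I|$ is the length of $I$. Then $E(\omega)=\bigcap_{k\ge1}E_k$. (Despite the name, the construction is deterministic.) Two Riemann surfaces are quasiconformally equivalent if there exists a quasiconformal homeomorphism of one onto the other. *)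

theory Defs
  imports "HOL-Complex_Analysis.Complex_Analysis"
begin

subsection \<open>The Cantor sets\<close>

text \<open>
  The intervals of stage \<open>k\<close>, each given by its pair of endpoints. Of \<open>[a, b]\<close> there remain the
  two closed intervals left over by the open interval of length \<open>q (k + 1) * (b - a)\<close> centred at
  \<open>(a + b) / 2\<close>. The value \<open>q 0\<close> is never used.
\<close>

fun cantor_intervals :: "(nat \<Rightarrow> real) \<Rightarrow> nat \<Rightarrow> (real \<times> real) set" where
  "cantor_intervals q 0 = {(0, 1)}"
| "cantor_intervals q (Suc k) =
     (\<Union>(a, b)\<in>cantor_intervals q k.
        {(a, (a + b) / 2 - q (Suc k) * (b - a) / 2),
         ((a + b) / 2 + q (Suc k) * (b - a) / 2, b)})"

definition cantor_stage :: "(nat \<Rightarrow> real) \<Rightarrow> nat \<Rightarrow> real set" where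
  "cantor_stage q k = (\<Union>(a, b)\<in>cantor_intervals q k. {a..b})"

definition random_cantor_set :: "(nat \<Rightarrow> real) \<Rightarrow> real set" where
  "random_cantor_set q = (\<Inter>k\<in>{1..}. cantor_stage q k)"

definition middle_third_cantor_set :: "real set" where
  "middle_third_cantor_set = random_cantor_set (\<lambda>n. 1 / 3)"


subsection \<open>Modulus of a family of plane curves\<close>

text \<open>
  The supremum of the lengths of inscribed polygons; \<open>incseq\<close> is the non-strict order, so repeated
  points are allowed.
\<close>

definition curve_length :: "(real \<Rightarrow> complex) \<Rightarrow> real set \<Rightarrow> ennreal" where
  "curve_length \<gamma> I =
     (SUP (n, t) \<in> {(n, t). incseq t \<and> range t \<subseteq> I}.
        \<Sum>i<n. ennreal (dist (\<gamma> (t i)) (\<gamma> (t (Suc i)))))"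

definition rectifiable :: "(real \<Rightarrow> complex) \<Rightarrow> bool" where
  "rectifiable \<gamma> \<longleftrightarrow> curve_length \<gamma> {0..1} < \<infinity>"

text \<open>
  For a rectifiable path the length of its restriction to \<open>[0, t]\<close> is a continuous nondecreasing
  function of \<open>t\<close>, constant outside \<open>[0, 1]\<close>. Its Lebesgue-Stieltjes measure is the arc length
  measure \<open>ds\<close> in the parameter of the path.
\<close>

definition arc_length_measure :: "(real \<Rightarrow> complex) \<Rightarrow> real measure" where
  "arc_length_measure \<gamma> =
     interval_measure (\<lambda>t. enn2real (curve_length \<gamma> ({0..1} \<inter> {..t})))"

definition line_integral :: "(complex \<Rightarrow> ennreal) \<Rightarrow> (real \<Rightarrow> complex) \<Rightarrow> ennreal" where
  "line_integral \<rho> \<gamma> = (\<integral>\<^sup>+t\<in>{0..1}. \<rho> (\<gamma> t) \<partial>arc_length_measure \<gamma>)"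

definition admissible :: "(complex \<Rightarrow> ennreal) \<Rightarrow> (real \<Rightarrow> complex) set \<Rightarrow> bool" where
  "admissible \<rho> \<Gamma> \<longleftrightarrow>
     \<rho> \<in> borel_measurable borel \<and> (\<forall>\<gamma>\<in>\<Gamma>. rectifiable \<gamma> \<longrightarrow> 1 \<le> line_integral \<rho> \<gamma>)"

definition curve_modulus :: "(real \<Rightarrow> complex) set \<Rightarrow> ennreal" where
  "curve_modulus \<Gamma> = (INF \<rho> \<in> {\<rho>. admissible \<rho> \<Gamma>}. \<integral>\<^sup>+z. (\<rho> z)\<^sup>2 \<partial>lborel)"


subsection \<open>Quasiconformal maps between open subsets of the plane\<close>

text \<open>
  For an injective continuous \<open>g\<close> the winding number below is \<open>1\<close> or \<open>-1\<close>, according to whether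
  \<open>g\<close> preserves or reverses the orientation near \<open>z\<close>.
\<close>

definition sense_preserving_on :: "complex set \<Rightarrow> (complex \<Rightarrow> complex) \<Rightarrow> bool" where
  "sense_preserving_on U g \<longleftrightarrow>
     (\<forall>z r. 0 < r \<and> cball z r \<subseteq> U \<longrightarrow> winding_number (g \<circ> circlepath z r) (g z) = 1)"

text \<open>
  The geometric definition of quasiconformality: \<open>g\<close> is a sense-preserving homeomorphism onto its
  image (which is open by invariance of domain) and changes the modulus of every family of paths
  in \<open>U\<close> at most by the factor \<open>K\<close>, in both directions.
\<close>

definition plane_quasiconformal ::
    "real \<Rightarrow> complex set \<Rightarrow> (complex \<Rightarrow> complex) \<Rightarrow> bool" where
  "plane_quasiconformal K U g \<longleftrightarrow>
     1 \<le> K \<and> open U \<and> continuous_on U g \<and> inj_on g U \<and> sense_preserving_on U g \<and>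
     (\<forall>\<Gamma>. \<Gamma> \<subseteq> {\<gamma>. path \<gamma> \<and> path_image \<gamma> \<subseteq> U} \<longrightarrow>
        curve_modulus \<Gamma> \<le> ennreal K * curve_modulus ((\<circ>) g ` \<Gamma>) \<and>
        curve_modulus ((\<circ>) g ` \<Gamma>) \<le> ennreal K * curve_modulus \<Gamma>)"


subsection \<open>The Riemann sphere\<close>

text \<open>The point \<open>None\<close> is the point at infinity.\<close>

definition riemann_sphere :: "complex option topology" where
  "riemann_sphere = Alexandroff_compactification euclidean"

text \<open>
  The conformal structure is given by the inverses of its two standard charts \<open>z\<close> and \<open>1 / z\<close>,
  defined on all of the plane.
\<close>

definition infinity_param :: "complex \<Rightarrow> complex option" where
  "infinity_param w = (if w = 0 then None else Some (inverse w))"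

definition sphere_params :: "(complex \<Rightarrow> complex option) set" where
  "sphere_params = {Some, infinity_param}"

text \<open>
  The expression of a map \<open>f\<close> on \<open>X\<close> with respect to the local coordinates \<open>inv \<phi>\<close> in the source
  and \<open>inv \<psi>\<close> in the target, and the set of points where this expression makes sense.
\<close>

definition coord_domain ::
    "(complex \<Rightarrow> complex option) \<Rightarrow> (complex \<Rightarrow> complex option) \<Rightarrow>
     complex option set \<Rightarrow> (complex option \<Rightarrow> complex option) \<Rightarrow> complex set" where
  "coord_domain \<phi> \<psi> X f = {z. \<phi> z \<in> X \<and> f (\<phi> z) \<in> range \<psi>}"

definition coord_map ::
    "(complex \<Rightarrow> complex option) \<Rightarrow> (complex \<Rightarrow> complex option) \<Rightarrow>
     (complex option \<Rightarrow> complex option) \<Rightarrow> complex \<Rightarrow> complex" where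
  "coord_map \<phi> \<psi> f = inv \<psi> \<circ> f \<circ> \<phi>"

text \<open>
  Open subsets \<open>X\<close>, \<open>Y\<close> of the sphere are considered as Riemann surfaces; a homeomorphism between
  them is \<open>K\<close>-quasiconformal if it is so in all local coordinates, with the same \<open>K\<close>.
\<close>

definition quasiconformal_homeo ::
    "real \<Rightarrow> complex option set \<Rightarrow> complex option set \<Rightarrow>
     (complex option \<Rightarrow> complex option) \<Rightarrow> bool" where
  "quasiconformal_homeo K X Y f \<longleftrightarrow>
     homeomorphic_map (subtopology riemann_sphere X) (subtopology riemann_sphere Y) f \<and>
     (\<forall>\<phi>\<in>sphere_params. \<forall>\<psi>\<in>sphere_params.
        plane_quasiconformal K (coord_domain \<phi> \<psi> X f) (coord_map \<phi> \<psi> f))"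

definition quasiconformally_equivalent ::
    "complex option set \<Rightarrow> complex option set \<Rightarrow> bool" where
  "quasiconformally_equivalent X Y \<longleftrightarrow> (\<exists>K f. quasiconformal_homeo K X Y f)"

definition sphere_complement :: "real set \<Rightarrow> complex option set" where
  "sphere_complement E = topspace riemann_sphere - Some ` complex_of_real ` E"

end

theory Submission
  imports Defs
begin

text \<open>
  Let \<open>b k\<close> be the length of the leftmost interval of stage \<open>k\<close> of \<open>E(q)\<close>. The square annulus
  \<open>2 b (k + 1) < max \<bar>Re z\<bar> \<bar>Im z\<bar> < b k / 2\<close> avoids \<open>E(q)\<close> and separates it, and the modulus of the
  family of concentric squares in it is at least a constant times \<open>ln (1 / (2 (1 - q (k + 1))))\<close>, hence
  unbounded in \<open>k\<close>. A quasiconformal map sends these squares to closed curves which all separate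
  the middle third set \<open>C\<close> into the same two closed pieces \<open>C1\<close> and \<open>C2\<close>. If \<open>d\<close> is the distance of
  the pieces, then by uniform perfectness both have diameter at least \<open>d / 6\<close>; so each of the curves
  crosses a shortest segment from \<open>C1\<close> to \<open>C2\<close> and does not stay in the disc of radius \<open>d / 13\<close>
  around the crossing point. A constant density on a disc of radius \<open>2 d\<close> therefore
  bounds the modulus of the image family independently of \<open>k\<close>. No Jordan curve theorem is needed,
  because a closed subset of the line without interior does not separate any plane domain.
\<close>

subsection \<open>Arc length\<close>

text \<open>The map is given only off the Cantor set and has no a priori extension to it, so
  \<open>C1\<close> and \<open>C2\<close> cannot be obtained as images of parts of \<open>E\<close>.
  They are the sets of limit points, in the target Cantor set, of the images of the two sides of the
  annulus. Properness of the homeomorphism makes both nonempty. They exhaust the target set and are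
  disjoint because a small disc around one of its points misses the image of the closed annulus and
  stays connected when the set is removed. A second obstacle is infinity: the modulus is one of
  plane curves, and a square may pass through the point whose image is infinity. Cutting the annulus
  at the geometric mean of its radii leaves a half that avoids this point and has half the
  logarithmic width. The final constant \<open>173056\<close> is \<open>32 * 2 * 2704\<close>: the
  constant for the squares, this halving, and the bound for the separating curves.\<close>

lemma polygon_le_curve_length:
  assumes "incseq t" "range t \<subseteq> I"
  shows "(\<Sum>i<n. ennreal (dist (\<gamma> (t i)) (\<gamma> (t (Suc i))))) \<le> curve_length \<gamma> I"
  unfolding curve_length_def by (rule SUP_upper2[where i = "(n, t)"]) (use assms in auto)

lemma curve_length_least:
  assumes "\<And>n t. incseq t \<Longrightarrow> range t \<subseteq> I \<Longrightarrow>
             (\<Sum>i<n. ennreal (dist (\<gamma> (t i)) (\<gamma> (t (Suc i))))) \<le> c"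
  shows "curve_length \<gamma> I \<le> c"
  unfolding curve_length_def by (rule SUP_least) (use assms in auto)

lemma curve_length_mono:
  assumes "I \<subseteq> J"
  shows "curve_length \<gamma> I \<le> curve_length \<gamma> J"
  by (rule curve_length_least, rule polygon_le_curve_length) (use assms in auto)

lemma dist_le_curve_length:
  assumes "s \<in> I" "t \<in> I" "s \<le> t"
  shows "ennreal (dist (\<gamma> s) (\<gamma> t)) \<le> curve_length \<gamma> I"
proof -
  have "incseq (\<lambda>i::nat. if i = 0 then s else t)"
    using assms by (auto simp: incseq_def)
  from polygon_le_curve_length[OF this, of I \<gamma> 1] assms show ?thesis
    by auto
qed

text \<open>A polygon over the left part followed by one over the right part is a polygon over
  \<open>I\<close>, and the joining edge has nonnegative length.\<close>

lemma curve_length_add_le: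
  assumes "t \<in> I"
  shows "curve_length \<gamma> (I \<inter> {..t}) + curve_length \<gamma> (I \<inter> {t..}) \<le> curve_length \<gamma> I"
proof -
  let ?d = "\<lambda>p i. ennreal (dist (\<gamma> (p i)) (\<gamma> (p (Suc i))))"
  let ?P = "\<lambda>J. {(n::nat, p). incseq p \<and> range p \<subseteq> J}"
  have "(\<Sum>i<n. ?d p i) + (\<Sum>i<m. ?d p' i) \<le> curve_length \<gamma> I"
    if p: "incseq p" "range p \<subseteq> I \<inter> {..t}" and p': "incseq p'" "range p' \<subseteq> I \<inter> {t..}"
    for n m :: nat and p p'
  proof -
    \<comment> \<open>The vertices \<open>p 0\<close>, ..., \<open>p n\<close> are followed by those
      of \<open>p'\<close>; the joining edge, from \<open>p n\<close> to \<open>p' 0\<close>, has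
      index \<open>n\<close>.\<close>
    define r where "r i = (if i \<le> n then p i else p' (i - Suc n))" for i
    have le: "p i \<le> p' j" for i j
      using p p' by (meson IntD2 atLeast_iff atMost_iff order_trans range_subsetD)
    have "incseq r"
      using p(1) p'(1) le by (auto simp: r_def incseq_def)
    moreover have "range r \<subseteq> I"
      using p(2) p'(2) by (auto simp: r_def)
    ultimately have "(\<Sum>i<n + Suc m. ?d r i) \<le> curve_length \<gamma> I"
      by (rule polygon_le_curve_length)
    moreover have "(\<Sum>i<n + Suc m. ?d r i) = (\<Sum>i<n. ?d r i) + (\<Sum>i<Suc m. ?d r (n + i))"
      by (induction m) (auto simp: add_ac)
    moreover have "(\<Sum>i<n. ?d r i) = (\<Sum>i<n. ?d p i)"
      by (intro sum.cong) (auto simp: r_def)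
    moreover have "(\<Sum>i<Suc m. ?d r (n + i)) = ?d r n + (\<Sum>i<m. ?d p' i)"
      unfolding sum.lessThan_Suc_shift by (simp add: r_def)
    ultimately have "(\<Sum>i<n. ?d p i) + (?d r n + (\<Sum>i<m. ?d p' i)) \<le> curve_length \<gamma> I"
      by metis
    moreover have "(\<Sum>i<m. ?d p' i) \<le> ?d r n + (\<Sum>i<m. ?d p' i)"
      by simp
    ultimately show ?thesis
      by (meson add_left_mono order_trans)
  qed
  then have "(SUP (m, p') \<in> ?P (I \<inter> {t..}). (\<Sum>i<n. ?d p i) + (\<Sum>i<m. ?d p' i)) \<le> curve_length \<gamma> I"
    if "incseq p" "range p \<subseteq> I \<inter> {..t}" for n p
    by (intro SUP_least) (use that in auto)
  moreover have "(SUP (m, p') \<in> ?P (I \<inter> {t..}). (\<Sum>i<n. ?d p i) + (\<Sum>i<m. ?d p' i)) =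
      (\<Sum>i<n. ?d p i) + curve_length \<gamma> (I \<inter> {t..})" for n p
  proof -
    \<comment> \<open>A one-point polygon makes the index set nonempty, as required for moving a
      constant through \<open>SUP\<close>.\<close>
    have "(0, \<lambda>_. t) \<in> ?P (I \<inter> {t..})"
      using assms by (auto simp: incseq_def)
    then have ne: "?P (I \<inter> {t..}) \<noteq> {}" by blast
    show ?thesis
      unfolding curve_length_def using ennreal_SUP_add_right[OF ne, where c = "\<Sum>i<n. ?d p i" and f = "\<lambda>(m, p'). \<Sum>i<m. ?d p' i"]
      by (simp add: case_prod_unfold)
  qed
  ultimately have *: "(\<Sum>i<n. ?d p i) + curve_length \<gamma> (I \<inter> {t..}) \<le> curve_length \<gamma> I"
    if "incseq p" "range p \<subseteq> I \<inter> {..t}" for n p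
    using that by simp
  have "(0, \<lambda>_. t) \<in> ?P (I \<inter> {..t})"
    using assms by (auto simp: incseq_def)
  then have ne: "?P (I \<inter> {..t}) \<noteq> {}" by blast
  have "curve_length \<gamma> (I \<inter> {..t}) + curve_length \<gamma> (I \<inter> {t..}) =
     (SUP (n, p) \<in> ?P (I \<inter> {..t}). (\<Sum>i<n. ?d p i) + curve_length \<gamma> (I \<inter> {t..}))"
    unfolding curve_length_def[of \<gamma> "I \<inter> {..t}"]
    using ennreal_SUP_add_left[OF ne, where c = "curve_length \<gamma> (I \<inter> {t..})" and f = "\<lambda>(n, p). \<Sum>i<n. ?d p i"]
    by (simp add: case_prod_unfold)
  also have "\<dots> \<le> curve_length \<gamma> I"
    by (intro SUP_least) (use * in auto)
  finally show ?thesis .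
qed

text \<open>Clamping the vertices of a polygon at \<open>t\<close> with \<open>min\<close> and
  \<open>max\<close> gives one polygon on each side; the triangle inequality matters only for an
  edge that jumps over \<open>t\<close>.\<close>

lemma curve_length_le_add:
  assumes "t \<in> I"
  shows "curve_length \<gamma> I \<le> curve_length \<gamma> (I \<inter> {..t}) + curve_length \<gamma> (I \<inter> {t..})"
proof (rule curve_length_least)
  fix n p assume p: "incseq p" "range p \<subseteq> I"
  let ?d = "\<lambda>p i. ennreal (dist (\<gamma> (p i)) (\<gamma> (p (Suc i))))"
  have "?d p i \<le> ?d (\<lambda>i. min (p i) t) i + ?d (\<lambda>i. max (p i) t) i" for i
  proof -
    have "p i \<le> p (Suc i)" using p(1) by (simp add: incseq_SucD)
    then have "dist (\<gamma> (p i)) (\<gamma> (p (Suc i))) \<le>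
      dist (\<gamma> (min (p i) t)) (\<gamma> (min (p (Suc i)) t)) + dist (\<gamma> (max (p i) t)) (\<gamma> (max (p (Suc i)) t))"
      by (cases "p i \<le> t"; cases "p (Suc i) \<le> t") (simp_all add: min_def max_def dist_triangle)
    from ennreal_leI[OF this] show ?thesis by simp
  qed
  then have "(\<Sum>i<n. ?d p i) \<le> (\<Sum>i<n. ?d (\<lambda>i. min (p i) t) i) + (\<Sum>i<n. ?d (\<lambda>i. max (p i) t) i)"
    by (simp only: sum.distrib[symmetric] sum_mono)
  also have "\<dots> \<le> curve_length \<gamma> (I \<inter> {..t}) + curve_length \<gamma> (I \<inter> {t..})"
  proof (intro add_mono polygon_le_curve_length)
    show "incseq (\<lambda>i. min (p i) t)"
      by (rule monoI, rule min.mono, rule monoD[OF p(1)], assumption, rule order_refl)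
    show "incseq (\<lambda>i. max (p i) t)"
      by (rule monoI, rule max.mono, rule monoD[OF p(1)], assumption, rule order_refl)
  qed (use p(2) assms in \<open>auto simp: min_def max_def\<close>)
  finally show "(\<Sum>i<n. ?d p i) \<le> curve_length \<gamma> (I \<inter> {..t}) + curve_length \<gamma> (I \<inter> {t..})" .
qed

lemma curve_length_add:
  assumes "t \<in> I"
  shows "curve_length \<gamma> (I \<inter> {..t}) + curve_length \<gamma> (I \<inter> {t..}) = curve_length \<gamma> I"
  by (intro antisym curve_length_add_le curve_length_le_add assms)

lemma curve_length_lipschitz:
  assumes "\<And>s t. a \<le> s \<Longrightarrow> s \<le> t \<Longrightarrow> t \<le> b \<Longrightarrow> dist (\<gamma> s) (\<gamma> t) \<le> L * (t - s)" and "0 \<le> L" "a \<le> b"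
  shows "curve_length \<gamma> {a..b} \<le> ennreal (L * (b - a))"
proof (rule curve_length_least)
  fix n :: nat and p assume p: "incseq p" "range p \<subseteq> {a..b}"
  then have ab: "a \<le> p i" "p i \<le> b" "p i \<le> p (Suc i)" for i
    by (auto simp: incseq_SucD image_subset_iff)
  have "(\<Sum>i<n. dist (\<gamma> (p i)) (\<gamma> (p (Suc i)))) \<le> (\<Sum>i<n. L * (p (Suc i) - p i))"
    by (intro sum_mono assms ab)
  also have "\<dots> = L * (p n - p 0)"
    unfolding sum_distrib_left[symmetric] by (simp add: sum_lessThan_telescope)
  also have "\<dots> \<le> L * (b - a)"
    using ab assms(2) by (intro mult_left_mono diff_mono) auto
  finally show "(\<Sum>i<n. ennreal (dist (\<gamma> (p i)) (\<gamma> (p (Suc i))))) \<le> ennreal (L * (b - a))"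
    by (simp add: ennreal_leI)
qed

definition arc_length :: "(real \<Rightarrow> complex) \<Rightarrow> real \<Rightarrow> real" where
  "arc_length \<gamma> t = enn2real (curve_length \<gamma> ({0..1} \<inter> {..t}))"

lemma arc_length_measure_eq: "arc_length_measure \<gamma> = interval_measure (arc_length \<gamma>)"
  by (simp add: arc_length_measure_def arc_length_def[abs_def])

lemma curve_length_finite:
  assumes "rectifiable \<gamma>" "I \<subseteq> {0..1}"
  shows "curve_length \<gamma> I < \<infinity>"
  using curve_length_mono[OF assms(2), of \<gamma>] assms(1) unfolding rectifiable_def by (rule order.strict_trans1)

lemma arc_length_mono:
  assumes "rectifiable \<gamma>" "s \<le> t"
  shows "arc_length \<gamma> s \<le> arc_length \<gamma> t"
  unfolding arc_length_def
  by (intro enn2real_mono curve_length_mono) (use assms curve_length_finite in auto)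

lemma arc_length_below: "t < 0 \<Longrightarrow> arc_length \<gamma> t = 0"
proof -
  assume "t < 0"
  then have "{0..1} \<inter> {..t} = {}" by auto
  then have "curve_length \<gamma> ({0..1} \<inter> {..t}) \<le> 0"
    by (intro curve_length_least) simp
  then show ?thesis by (simp add: arc_length_def)
qed

lemma arc_length_above: "1 \<le> t \<Longrightarrow> arc_length \<gamma> t = arc_length \<gamma> 1"
proof -
  assume "1 \<le> t"
  then have "{0..1} \<inter> {..t} = {0..1} \<inter> {..1}" by auto
  then show ?thesis by (simp only: arc_length_def)
qed

lemma arc_length_add:
  assumes "rectifiable \<gamma>" "0 \<le> s" "s \<le> t" "t \<le> 1"
  shows "arc_length \<gamma> t = arc_length \<gamma> s + enn2real (curve_length \<gamma> {s..t})"
proof -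
  have eq: "{0..1} \<inter> {..t} \<inter> {..s} = {0..1} \<inter> {..s}" "{0..1} \<inter> {..t} \<inter> {s..} = {s..t}"
    using assms by auto
  have "curve_length \<gamma> ({0..1} \<inter> {..t}) = curve_length \<gamma> ({0..1} \<inter> {..s}) + curve_length \<gamma> {s..t}"
    using curve_length_add[of s "{0..1} \<inter> {..t}" \<gamma>] assms unfolding eq by simp
  moreover have "curve_length \<gamma> ({0..1} \<inter> {..s}) < \<infinity>" "curve_length \<gamma> {s..t} < \<infinity>"
    by (rule curve_length_finite; use assms in auto)+
  ultimately show ?thesis
    by (simp add: arc_length_def enn2real_plus)
qed

lemma dist_le_arc_length:
  assumes "rectifiable \<gamma>" "0 \<le> s" "s \<le> t" "t \<le> 1"
  shows "dist (\<gamma> s) (\<gamma> t) \<le> arc_length \<gamma> t - arc_length \<gamma> s"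
proof -
  have "ennreal (dist (\<gamma> s) (\<gamma> t)) \<le> curve_length \<gamma> {s..t}"
    using assms by (intro dist_le_curve_length) auto
  moreover have "curve_length \<gamma> {s..t} < \<infinity>"
    by (rule curve_length_finite) (use assms in auto)
  ultimately have "enn2real (ennreal (dist (\<gamma> s) (\<gamma> t))) \<le> enn2real (curve_length \<gamma> {s..t})"
    by (intro enn2real_mono) auto
  then have "dist (\<gamma> s) (\<gamma> t) \<le> enn2real (curve_length \<gamma> {s..t})"
    by simp
  with arc_length_add[OF assms] show ?thesis by simp
qed

text \<open>Right continuity is what gives \<open>interval_measure\<close> its expected values. It
  comes from the tail: a polygon almost as long as the curve on \<open>{a..1}\<close> changes its
  length continuously when its vertices are pushed to the right of \<open>u\<close>, so the length
  on \<open>{u..1}\<close> cannot drop suddenly.\<close>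

lemma continuous_at_right_arc_length:
  assumes "path \<gamma>" "rectifiable \<gamma>"
  shows "continuous (at_right a) (arc_length \<gamma>)"
proof -
  consider "a < 0" | "1 \<le> a" | "0 \<le> a" "a < 1" by linarith
  then show ?thesis
  proof cases
    case 1
    have "eventually (\<lambda>t. arc_length \<gamma> t = arc_length \<gamma> a) (at_right a)"
      unfolding eventually_at_right_field using 1 by (intro exI[of _ 0]) (simp add: arc_length_below)
    then show ?thesis
      unfolding continuous_within by (rule tendsto_eventually)
  next
    case 2
    have "eventually (\<lambda>t. arc_length \<gamma> t = arc_length \<gamma> a) (at_right a)"
    proof (rule eventually_mono[OF eventually_at_right_less])
      fix t assume "a < t"
      with 2 have "1 \<le> t" by simp
      from trans[OF arc_length_above[OF this] arc_length_above[OF 2, symmetric]]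
      show "arc_length \<gamma> t = arc_length \<gamma> a" .
    qed
    then show ?thesis
      unfolding continuous_within by (rule tendsto_eventually)
  next
    case 3
    \<comment> \<open>By monotonicity a single \<open>b\<close> controls all parameters between
      \<open>a\<close> and \<open>b\<close>.\<close>
    have "\<exists>b>a. b \<le> 1 \<and> arc_length \<gamma> b < arc_length \<gamma> a + e" if "0 < e" for e
    proof -
      have fin: "curve_length \<gamma> {u..1} < \<infinity>" if "0 \<le> u" for u
        by (rule curve_length_finite) (use that assms in auto)
      let ?G = "\<lambda>u. enn2real (curve_length \<gamma> {u..1})"
      have GF: "arc_length \<gamma> 1 = arc_length \<gamma> u + ?G u" if "0 \<le> u" "u \<le> 1" for u
        using arc_length_add[OF assms(2), of u 1] that by auto
      obtain n p where p: "incseq p" "range p \<subseteq> {a..1}"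
        and gt: "?G a - e / 2 < (\<Sum>i<n. dist (\<gamma> (p i)) (\<gamma> (p (Suc i))))"
      proof (rule ccontr)
        assume neg: "\<not> thesis"
        note thesisI = that
        have le: "(\<Sum>i<n. dist (\<gamma> (p i)) (\<gamma> (p (Suc i)))) \<le> ?G a - e / 2"
          if "incseq p" "range p \<subseteq> {a..1}" for n :: nat and p
          using neg thesisI[OF that, of n] by (meson not_le)
        have "curve_length \<gamma> {a..1} \<le> ennreal (?G a - e / 2)"
        proof (rule curve_length_least)
          fix n :: nat and t assume "incseq t" "range t \<subseteq> {a..1}"
          from ennreal_leI[OF le[OF this, of n]]
          show "(\<Sum>i<n. ennreal (dist (\<gamma> (t i)) (\<gamma> (t (Suc i))))) \<le> ennreal (?G a - e / 2)"
            by simp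
        qed
        moreover have "0 \<le> ?G a - e / 2"
          using le[of "\<lambda>_. a" 0] 3 by (auto simp: incseq_def)
        ultimately have "?G a \<le> ?G a - e / 2"
          by (metis enn2real_ennreal enn2real_mono ennreal_less_top)
        with \<open>0 < e\<close> show False by simp
      qed
      \<comment> \<open>The chosen polygon with its vertices clamped to \<open>{u..1}\<close>: its
        length is continuous in \<open>u\<close> and a lower bound for the tail
        \<open>?G u\<close>.\<close>
      define V where "V u = (\<Sum>i<n. dist (\<gamma> (max (p i) u)) (\<gamma> (max (p (Suc i)) u)))" for u
      have Va: "V a = (\<Sum>i<n. dist (\<gamma> (p i)) (\<gamma> (p (Suc i))))"
      proof -
        have "max (p i) a = p i" for i
          using p(2) by (simp add: max_def image_subset_iff antisym)
        then show ?thesis by (simp add: V_def)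
      qed
      have VG: "V u \<le> ?G u" if "a \<le> u" "u \<le> 1" for u
      proof -
        have "incseq (\<lambda>i. max (p i) u)"
          by (rule monoI, rule max.mono, rule monoD[OF p(1)], assumption, rule order_refl)
        moreover have "range (\<lambda>i. max (p i) u) \<subseteq> {u..1}"
          using p(2) that by (auto simp: image_subset_iff)
        ultimately
        have "ennreal (V u) \<le> curve_length \<gamma> {u..1}"
          using polygon_le_curve_length[of "\<lambda>i. max (p i) u" "{u..1}" \<gamma> n] by (simp add: V_def)
        then show ?thesis
          using fin[of u] that 3 enn2real_mono[of "ennreal (V u)" "curve_length \<gamma> {u..1}"]
          by (simp add: V_def sum_nonneg)
      qed
      have "continuous_on {a..1} (\<lambda>u. \<gamma> (max (p i) u))" for i
        by (rule continuous_on_compose2[of "{0..1}" \<gamma>])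
           (use assms(1) p(2) 3 in \<open>auto simp: path_def image_subset_iff intro!: continuous_intros elim: order_trans\<close>)
      then have "continuous_on {a..1} V"
        unfolding V_def by (intro continuous_intros)
      then have "(V \<longlongrightarrow> V a) (at a within {a..1})"
        using 3 by (simp add: continuous_on_def)
      then have "\<forall>\<^sub>F u in at a within {a..1}. dist (V u) (V a) < e / 2"
        by (rule tendstoD) (use \<open>0 < e\<close> in simp)
      then have "\<forall>\<^sub>F u in at_right a. dist (V u) (V a) < e / 2"
        using at_within_Icc_at_right[of a 1] 3 by simp
      then obtain c where c: "a < c" "\<And>u. a < u \<Longrightarrow> u < c \<Longrightarrow> dist (V u) (V a) < e / 2"
        unfolding eventually_at_right_field by blast
      define b where "b = min ((a + c) / 2) 1"
      have b: "a < b" "b < c" "b \<le> 1" using c(1) 3 by (auto simp: b_def min_def)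
      have "?G b > ?G a - e"
      proof -
        have "V a - e / 2 < V b"
          using c(2)[OF b(1,2)] unfolding dist_real_def by linarith
        with gt Va VG[of b] b show ?thesis by linarith
      qed
      with GF[of a] GF[of b] b 3 show ?thesis
        by (intro exI[of _ b]) auto
    qed
    then have "eventually (\<lambda>t. dist (arc_length \<gamma> t) (arc_length \<gamma> a) < e) (at_right a)" if "0 < e" for e
      using that arc_length_mono[OF assms(2)] unfolding eventually_at_right_field
      by (smt (verit, best) dist_real_def)
    then show ?thesis
      unfolding continuous_within tendsto_iff by blast
  qed
qed

lemma emeasure_arc_length_measure:
  assumes "path \<gamma>" "rectifiable \<gamma>" "a \<le> b"
  shows "emeasure (arc_length_measure \<gamma>) {a<..b} = ennreal (arc_length \<gamma> b - arc_length \<gamma> a)"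
  unfolding arc_length_measure_eq
  by (rule emeasure_interval_measure_Ioc)
     (use assms arc_length_mono continuous_at_right_arc_length in auto)

subsection \<open>Square annuli\<close>

text \<open>The maximum norm replaces the modulus so that, in each of the four diagonal sectors of
  the plane, the radius is a Cartesian coordinate up to a quarter turn. Area integrals then need
  only Fubini and affine substitutions.\<close>

definition sq_norm :: "complex \<Rightarrow> real" where
  "sq_norm z = max \<bar>Re z\<bar> \<bar>Im z\<bar>"

text \<open>
  The unit square is described by the triangle waves \<open>P = Re + Im\<close> and \<open>M = Re - Im\<close>, in terms of
  which \<open>\<bar>Re\<bar> + \<bar>Im\<bar> = max \<bar>P\<bar> \<bar>M\<bar>\<close>; this gives the sharp Lipschitz constant.
\<close>

definition unit_square_path :: "real \<Rightarrow> complex" where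
  "unit_square_path t =
     (let P = max (2 - 8 * \<bar>t - 1 / 4\<bar>) (8 * t - 8); M = 8 * \<bar>t - 1 / 2\<bar> - 2
      in Complex ((P + M) / 2) ((P - M) / 2))"

definition square_path :: "real \<Rightarrow> real \<Rightarrow> complex" where
  "square_path r t = of_real r * unit_square_path t"

text \<open>\<open>P\<close> and \<open>M\<close> have slopes at most \<open>8\<close>, the
  perimeter of the square, and \<open>cmod\<close> is at most the sum of the absolute values of the
  coordinates.\<close>

lemma unit_square_path_lipschitz:
  assumes "s \<le> t"
  shows "dist (unit_square_path s) (unit_square_path t) \<le> 8 * (t - s)"
proof -
  let ?P = "\<lambda>t::real. max (2 - 8 * \<bar>t - 1 / 4\<bar>) (8 * t - 8)" and ?M = "\<lambda>t::real. 8 * \<bar>t - 1 / 2\<bar> - 2"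
  let ?d = "unit_square_path s - unit_square_path t"
  have max: "\<bar>max a b - max c d\<bar> \<le> K" if "\<bar>a - c\<bar> \<le> K" "\<bar>b - d\<bar> \<le> K" for a b c d K :: real
    using that by (smt (verit) max_def)
  have "\<bar>?P s - ?P t\<bar> \<le> 8 * (t - s)"
  proof (rule max)
    show "\<bar>2 - 8 * \<bar>s - 1 / 4\<bar> - (2 - 8 * \<bar>t - 1 / 4\<bar>)\<bar> \<le> 8 * (t - s)" using assms by (simp add: abs_if)
    show "\<bar>8 * s - 8 - (8 * t - 8)\<bar> \<le> 8 * (t - s)" using assms by (simp add: abs_if)
  qed
  moreover have "\<bar>?M s - ?M t\<bar> \<le> 8 * (t - s)"
    using assms by (simp add: abs_if)
  moreover have "Re ?d = ((?P s - ?P t) + (?M s - ?M t)) / 2" "Im ?d = ((?P s - ?P t) - (?M s - ?M t)) / 2"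
    by (simp_all add: unit_square_path_def Let_def field_simps)
  moreover have "\<bar>(a + b) / 2\<bar> + \<bar>(a - b) / 2\<bar> \<le> K" if "\<bar>a\<bar> \<le> K" "\<bar>b\<bar> \<le> K" for a b K :: real
    using that by (auto simp: abs_if field_simps)
  ultimately have "\<bar>Re ?d\<bar> + \<bar>Im ?d\<bar> \<le> 8 * (t - s)"
    by metis
  with cmod_le[of ?d] show ?thesis
    by (simp add: dist_norm)
qed

text \<open>Side \<open>k\<close> is the right-hand side turned by \<open>\<i> ^ k\<close>. It is
  traversed in the quarter of the time centred at \<open>(2 * k + 1) / 8\<close>, with
  \<open>v\<close> the position relative to its midpoint.\<close>

lemma unit_square_path_side:
  assumes "-1 \<le> v" "v \<le> 1" "k < 4"
  shows "unit_square_path ((2 * real k + 1) / 8 + v / 8) = \<i> ^ k * (1 + \<i> * of_real v)"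
proof -
  have *: "unit_square_path t = Complex ((p + m) / 2) ((p - m) / 2)"
    if "p = max (2 - 8 * \<bar>t - 1 / 4\<bar>) (8 * t - 8)" "m = 8 * \<bar>t - 1 / 2\<bar> - 2" for t p m
    using that by (simp add: unit_square_path_def Let_def)
  have "unit_square_path (1 / 8 + v / 8) = Complex 1 v"
    using *[of "1 + v" "1 / 8 + v / 8" "1 - v"] assms(1,2) by (simp add: abs_if max_def)
  moreover have "unit_square_path (3 / 8 + v / 8) = Complex (- v) 1"
    using *[of "1 - v" "3 / 8 + v / 8" "- 1 - v"] assms(1,2) by (simp add: abs_if max_def)
  moreover have "unit_square_path (5 / 8 + v / 8) = Complex (- 1) (- v)"
    using *[of "- 1 - v" "5 / 8 + v / 8" "v - 1"] assms(1,2) by (simp add: abs_if max_def)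
  moreover have "unit_square_path (7 / 8 + v / 8) = Complex v (- 1)"
    using *[of "v - 1" "7 / 8 + v / 8" "v + 1"] assms(1,2) by (simp add: abs_if max_def)
  moreover have "k = 0 \<or> k = 1 \<or> k = 2 \<or> k = 3" using assms(3) by linarith
  ultimately show ?thesis
    by (elim disjE) (simp_all add: complex_eq_iff power3_eq_cube)
qed

lemma unit_square_path_cases:
  assumes "t \<in> {0..1}"
  obtains k v where "k < 4" "-1 \<le> v" "v \<le> 1" "t = (2 * real k + 1) / 8 + v / 8"
proof -
  consider "t \<le> 1/4" | "1/4 \<le> t" "t \<le> 1/2" | "1/2 \<le> t" "t \<le> 3/4" | "3/4 \<le> t" by linarith
  then show ?thesis
    by cases (rule that[of 0 "8*t-1"] that[of 1 "8*t-3"] that[of 2 "8*t-5"] that[of 3 "8*t-7"];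
      use assms in \<open>simp add: field_simps; fail\<close>)+
qed

lemma path_image_square_path:
  assumes "0 < r"
  shows "path_image (square_path r) = {z. sq_norm z = r}"
proof (intro equalityI subsetI)
  fix z assume "z \<in> path_image (square_path r)"
  then obtain t where t: "t \<in> {0..1}" "z = square_path r t"
    by (auto simp: path_image_def)
  from t(1) obtain k v where "k < 4" "-1 \<le> v" "v \<le> 1" and tt: "t = (2 * real k + 1) / 8 + v / 8"
    by (rule unit_square_path_cases)
  then have z: "z = of_real r * (\<i> ^ k * (1 + \<i> * of_real v))" and v: "\<bar>r * v\<bar> \<le> r"
    using t assms by (auto simp: square_path_def unit_square_path_side abs_mult mult_left_le)
  consider "k = 0" | "k = 1" | "k = 2" | "k = 3" using \<open>k < 4\<close> by linarith
  then show "z \<in> {z. sq_norm z = r}"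
    by cases (use v assms in \<open>auto simp: z sq_norm_def power3_eq_cube max_def\<close>)
next
  fix z assume "z \<in> {z. sq_norm z = r}"
  then have z: "\<bar>Re z\<bar> \<le> r" "\<bar>Im z\<bar> \<le> r" "Re z = r \<or> Im z = r \<or> Re z = -r \<or> Im z = -r"
    by (auto simp: sq_norm_def max_def abs_if split: if_splits)
  have *: "of_real r * (\<i> ^ k * (1 + \<i> * of_real v)) \<in> path_image (square_path r)"
    if "k < 4" "-1 \<le> v" "v \<le> 1" for k v
  proof -
    have "(2 * real k + 1) / 8 + v / 8 \<in> {0..1}"
      using that by (auto simp: less_Suc_eq numeral_eq_Suc)
    then show ?thesis
      unfolding path_image_def using that by (auto simp: square_path_def unit_square_path_side intro!: image_eqI[rotated])
  qed
  have b: "-1 \<le> Re z / r" "Re z / r \<le> 1" "-1 \<le> Im z / r" "Im z / r \<le> 1"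
    using z(1,2) assms by (auto simp: field_simps abs_le_iff)
  show "z \<in> path_image (square_path r)"
    using z(3)
  proof (elim disjE)
    assume "Re z = r"
    then have "z = of_real r * (\<i> ^ 0 * (1 + \<i> * of_real (Im z / r)))"
      using assms by (simp add: complex_eq_iff)
    with *[of 0 "Im z / r"] b show ?thesis by simp
  next
    assume "Im z = r"
    then have "z = of_real r * (\<i> ^ 1 * (1 + \<i> * of_real (- Re z / r)))"
      using assms by (simp add: complex_eq_iff)
    with *[of 1 "- Re z / r"] b show ?thesis by simp
  next
    assume "Re z = - r"
    then have "z = of_real r * (\<i> ^ 2 * (1 + \<i> * of_real (- Im z / r)))"
      using assms by (simp add: complex_eq_iff)
    with *[of 2 "- Im z / r"] b show ?thesis by simp
  next
    assume "Im z = - r"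
    then have "z = of_real r * (\<i> ^ 3 * (1 + \<i> * of_real (Re z / r)))"
      using assms by (simp add: complex_eq_iff power3_eq_cube)
    with *[of 3 "Re z / r"] b show ?thesis by simp
  qed
qed

lemma continuous_on_unit_square_path: "continuous_on A unit_square_path"
  unfolding unit_square_path_def Let_def by (intro continuous_intros) simp_all

lemma path_square_path: "path (square_path r)"
  unfolding path_def square_path_def by (intro continuous_intros continuous_on_unit_square_path)

lemma square_path_lipschitz:
  assumes "0 \<le> r" "s \<le> t"
  shows "dist (square_path r s) (square_path r t) \<le> 8 * r * (t - s)"
proof -
  have "dist (square_path r s) (square_path r t) = r * dist (unit_square_path s) (unit_square_path t)"
    using assms by (simp add: square_path_def dist_norm norm_mult flip: right_diff_distrib)
  with mult_left_mono[OF unit_square_path_lipschitz[OF assms(2)] assms(1)] show ?thesis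
    by (simp add: mult_ac)
qed

lemma rectifiable_square_path:
  assumes "0 \<le> r"
  shows "rectifiable (square_path r)"
proof -
  have "curve_length (square_path r) {0..1} \<le> ennreal (8 * r * (1 - 0))"
    using assms by (intro curve_length_lipschitz square_path_lipschitz) auto
  then show ?thesis
    unfolding rectifiable_def by (rule order.strict_trans1) simp
qed

lemma arc_length_square_path_diff_le:
  assumes "0 \<le> r" "0 \<le> s" "s \<le> t" "t \<le> 1"
  shows "arc_length (square_path r) t - arc_length (square_path r) s \<le> 8 * r * (t - s)"
proof -
  have "curve_length (square_path r) {s..t} \<le> ennreal (8 * r * (t - s))"
    using assms by (intro curve_length_lipschitz square_path_lipschitz) auto
  then have "enn2real (curve_length (square_path r) {s..t}) \<le> 8 * r * (t - s)"
    using assms by (intro enn2real_leI) auto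
  with arc_length_add[OF rectifiable_square_path assms(2-4)] assms(1) show ?thesis
    by simp
qed

text \<open>The four chords between corners give total length at least \<open>8 * r\<close>, while
  the Lipschitz bound gives at most \<open>8 * r * t\<close> up to time \<open>t\<close> and at most
  \<open>8 * r * (1 - t)\<close> after it; hence equality throughout.\<close>

lemma arc_length_square_path:
  assumes "0 \<le> r" "t \<in> {0..1}"
  shows "arc_length (square_path r) t = 8 * r * t"
proof -
  let ?F = "arc_length (square_path r)"
  have side: "2 * r \<le> ?F ((real k + 1) / 4) - ?F (real k / 4)" if "k < 4" for k
  proof -
    have "unit_square_path (real k / 4) = \<i> ^ k * (1 + \<i> * of_real (-1))"
      "unit_square_path ((real k + 1) / 4) = \<i> ^ k * (1 + \<i> * of_real 1)"
      using unit_square_path_side[of "-1" k] unit_square_path_side[of 1 k] that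
      by (simp_all add: add_divide_distrib add_ac)
    then have "square_path r (real k / 4) - square_path r ((real k + 1) / 4) = - (2 * of_real r * \<i> ^ Suc k)"
      by (simp only: square_path_def) (simp add: algebra_simps)
    then have "dist (square_path r (real k / 4)) (square_path r ((real k + 1) / 4)) = 2 * r"
      using assms by (simp add: dist_norm norm_mult norm_power)
    moreover have "dist (square_path r (real k / 4)) (square_path r ((real k + 1) / 4))
        \<le> ?F ((real k + 1) / 4) - ?F (real k / 4)"
      using that assms by (intro dist_le_arc_length rectifiable_square_path) auto
    ultimately show ?thesis by simp
  qed
  have 1: "8 * r \<le> ?F 1 - ?F 0"
    using side[of 0] side[of 1] side[of 2] side[of 3] by simp
  have 0: "?F 0 = 0"
  proof -
    have "curve_length (square_path r) {0..0} \<le> ennreal (8 * r * (0 - 0))"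
      using assms by (intro curve_length_lipschitz square_path_lipschitz) auto
    moreover have "{0..1} \<inter> {..0} = {0..0::real}" by auto
    ultimately show ?thesis by (simp add: arc_length_def)
  qed
  from 1 0 arc_length_square_path_diff_le[OF assms(1), of 0 t] arc_length_square_path_diff_le[OF assms(1), of t 1] assms(2)
  show ?thesis by (auto simp: algebra_simps)
qed

text \<open>The path has constant speed \<open>8 * r\<close>; half-open intervals suffice to
  identify the measures.\<close>

lemma arc_length_measure_square_path:
  assumes "0 \<le> r"
  shows "arc_length_measure (square_path r) = density lborel (\<lambda>t. ennreal (8 * r) * indicator {0..1} t)"
proof (rule measure_eqI_generator_eq[where E = "range (\<lambda>(a, b). {a<..b::real})" and \<Omega> = UNIV
      and A = "\<lambda>n. {- real n<..real n}"])
  show "Int_stable (range (\<lambda>(a, b). {a<..b::real}))"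
    by (auto simp: Int_stable_def image_iff) 
  show "sets (arc_length_measure (square_path r)) = sigma_sets UNIV (range (\<lambda>(a, b). {a<..b::real}))"
    by (simp add: arc_length_measure_eq borel_sigma_sets_Ioc)
  show "sets (density lborel (\<lambda>t. ennreal (8 * r) * indicator {0..1} t)) = sigma_sets UNIV (range (\<lambda>(a, b). {a<..b::real}))"
    by (simp add: borel_sigma_sets_Ioc)
  show "(\<Union>n. {- real n<..real n}) = UNIV"
  proof -
    have "\<exists>n. - real n < x \<and> x \<le> real n" for x
      using reals_Archimedean2[of "\<bar>x\<bar>"] by (metis abs_less_iff less_imp_le minus_less_iff)
    then show ?thesis by auto
  qed
  show "emeasure (arc_length_measure (square_path r)) {- real n<..real n} \<noteq> \<infinity>" for n
    using assms by (simp add: emeasure_arc_length_measure path_square_path rectifiable_square_path)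
next
  fix X assume "X \<in> range (\<lambda>(a, b). {a<..b::real})"
  then obtain a b where X: "X = {a<..b}" by auto
  show "emeasure (arc_length_measure (square_path r)) X =
      emeasure (density lborel (\<lambda>t. ennreal (8 * r) * indicator {0..1} t)) X"
  proof (cases "a \<le> b")
    case True
    let ?c = "\<lambda>t. max 0 (min 1 t) :: real"
    have F: "arc_length (square_path r) t = 8 * r * ?c t" for t
      using arc_length_square_path[of r t] arc_length_square_path[of r 1] arc_length_above[of t "square_path r"]
        arc_length_below[of t "square_path r"] assms
      by (auto simp: max_def min_def)
    have "emeasure lborel ({0..1} \<inter> {a<..b}) = ennreal (?c b - ?c a)"
    proof -
      consider "0 \<le> a" | "a < 0" "0 \<le> b" | "b < 0" by linarith
      then show ?thesis
      proof cases
        case 1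
        then have "{0..1} \<inter> {a<..b} = {a<..min 1 b}" by auto
        with 1 True show ?thesis by (auto simp: min_def max_def)
      next
        case 2
        then have "{0..1} \<inter> {a<..b} = {0..min 1 b}" by auto
        with 2 True show ?thesis by (auto simp: min_def max_def)
      next
        case 3
        then have "{0..1} \<inter> {a<..b} = {}" by auto
        with 3 True show ?thesis by (auto simp: min_def max_def)
      qed
    qed
    moreover have "emeasure (density lborel (\<lambda>t. ennreal (8 * r) * indicator {0..1} t)) {a<..b} =
        ennreal (8 * r) * emeasure lborel ({0..1} \<inter> {a<..b})"
      by (subst emeasure_density)
         (auto simp: mult.assoc nn_integral_cmult simp flip: indicator_inter_arith intro!: nn_integral_indicator)
    moreover have "?c a \<le> ?c b" using True by (auto simp: max_def min_def)
    ultimately show ?thesis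
      using True assms
      by (simp add: X emeasure_arc_length_measure path_square_path rectifiable_square_path F
          ennreal_mult right_diff_distrib flip: ennreal_mult)
  qed (simp add: X)
qed auto

lemma line_integral_square_path:
  assumes "0 \<le> r" and [measurable]: "\<rho> \<in> borel_measurable borel"
  shows "line_integral \<rho> (square_path r) =
           (\<integral>\<^sup>+t. ennreal (8 * r) * \<rho> (square_path r t) * indicator {0..1} t \<partial>lborel)"
proof -
  have [measurable]: "square_path r \<in> borel_measurable borel"
    unfolding square_path_def
    by (intro borel_measurable_continuous_onI continuous_intros continuous_on_unit_square_path)
  show ?thesis
    unfolding line_integral_def arc_length_measure_square_path[OF assms(1)]
    by (subst nn_integral_density) (auto intro!: nn_integral_cong split: split_indicator)
qed

section \<open>Area integrals over sectors and the modulus of concentric squares\<close>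

lemma nn_integral_lborel_complex:
  assumes [measurable]: "f \<in> borel_measurable borel"
  shows "(\<integral>\<^sup>+z. f z \<partial>lborel) = (\<integral>\<^sup>+x. \<integral>\<^sup>+y. f (Complex x y) \<partial>lborel \<partial>lborel)"
proof -
  have c: "continuous_on UNIV (\<lambda>(x, y). Complex x y)"
    by (simp add: case_prod_unfold continuous_on_Complex continuous_on_fst continuous_on_snd continuous_on_id)
  then have [measurable]: "(\<lambda>(x, y). Complex x y) \<in> borel_measurable borel"
    by (rule borel_measurable_continuous_onI)
  have "(lborel :: complex measure) = distr lborel borel (\<lambda>(x, y). Complex x y)"
  proof (rule lborel_eqI)
    fix l u :: complex assume le: "\<And>b. b \<in> Basis \<Longrightarrow> l \<bullet> b \<le> u \<bullet> b"
    have "(\<lambda>(x, y). Complex x y) -` box l u = box (Re l) (Re u) \<times> box (Im l) (Im u)"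
      by (auto simp: box_def Basis_complex_def inner_complex_def)
    then have "emeasure (distr lborel borel (\<lambda>(x, y). Complex x y)) (box l u) =
        emeasure (lborel \<Otimes>\<^sub>M lborel) (box (Re l) (Re u) \<times> box (Im l) (Im u))"
      by (simp add: emeasure_distr lborel_prod)
    also have "\<dots> = emeasure lborel (box (Re l) (Re u)) * emeasure lborel (box (Im l) (Im u))"
      by (rule lborel.emeasure_pair_measure_Times) auto
    also have "\<dots> = (\<Prod>b\<in>Basis. (u - l) \<bullet> b)"
      using le[of 1] le[of \<i>] by (simp add: Basis_complex_def inner_complex_def ennreal_mult)
    finally show "emeasure (distr lborel borel (\<lambda>(x, y). Complex x y)) (box l u) = (\<Prod>b\<in>Basis. (u - l) \<bullet> b)" .
  qed simp
  then have "(\<integral>\<^sup>+z. f z \<partial>lborel) = (\<integral>\<^sup>+z. f z \<partial>distr lborel borel (\<lambda>(x, y). Complex x y))"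
    by simp
  also have "\<dots> = (\<integral>\<^sup>+p. f (case p of (x, y) \<Rightarrow> Complex x y) \<partial>(lborel \<Otimes>\<^sub>M lborel))"
    by (subst nn_integral_distr) (auto simp: lborel_prod)
  also have "\<dots> = (\<integral>\<^sup>+x. \<integral>\<^sup>+y. f (Complex x y) \<partial>lborel \<partial>lborel)"
    by (subst lborel.nn_integral_fst[symmetric]) (auto simp: lborel_prod)
  finally show ?thesis .
qed

text \<open>Multiplication by \<open>\<i>\<close> swaps the coordinates and reflects one of them, so
  Fubini and a reflection of the real line suffice.\<close>

lemma nn_integral_lborel_mult_ii:
  assumes [measurable]: "f \<in> borel_measurable borel"
  shows "(\<integral>\<^sup>+z. f (\<i> * z) \<partial>lborel) = (\<integral>\<^sup>+z. f z \<partial>lborel)"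
proof -
  have c: "continuous_on UNIV (\<lambda>(x, y). Complex x y)"
    by (simp add: case_prod_unfold continuous_on_Complex continuous_on_fst continuous_on_snd continuous_on_id)
  then have [measurable]: "(\<lambda>(x, y). Complex x y) \<in> borel_measurable (lborel \<Otimes>\<^sub>M lborel)"
    by (simp add: lborel_prod borel_measurable_continuous_onI)
  have [measurable]: "Complex x \<in> borel_measurable borel" for x
    by (intro borel_measurable_continuous_onI continuous_intros)
  have [measurable]: "(\<lambda>x. Complex x y) \<in> borel_measurable borel" for y
    by (intro borel_measurable_continuous_onI continuous_intros)
  have "(\<integral>\<^sup>+z. f (\<i> * z) \<partial>lborel) = (\<integral>\<^sup>+x. \<integral>\<^sup>+y. f (Complex (- y) x) \<partial>lborel \<partial>lborel)"
    by (subst nn_integral_lborel_complex) (auto simp: complex_eq_iff intro!: nn_integral_cong arg_cong[where f = f])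
  also have "\<dots> = (\<integral>\<^sup>+x. \<integral>\<^sup>+y. f (Complex y x) \<partial>lborel \<partial>lborel)"
    by (subst nn_integral_real_affine[where c = "-1" and t = 0 and f = "\<lambda>y. f (Complex y x)" for x]) auto
  also have "\<dots> = (\<integral>\<^sup>+y. \<integral>\<^sup>+x. f (Complex y x) \<partial>lborel \<partial>lborel)"
    by (rule lborel_pair.Fubini'[symmetric]) (simp add: case_prod_unfold)
  also have "\<dots> = (\<integral>\<^sup>+z. f z \<partial>lborel)"
    by (rule nn_integral_lborel_complex[symmetric]) simp
  finally show ?thesis .
qed

lemma nn_integral_lborel_mult_ii_power:
  assumes [measurable]: "f \<in> borel_measurable borel"
  shows "(\<integral>\<^sup>+z. f (\<i> ^ k * z) \<partial>lborel) = (\<integral>\<^sup>+z. f z \<partial>lborel)"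
proof (induction k)
  case (Suc k)
  have "(\<integral>\<^sup>+z. f (\<i> ^ Suc k * z) \<partial>lborel) = (\<integral>\<^sup>+z. f (\<i> ^ k * (\<i> * z)) \<partial>lborel)"
    by (simp add: mult_ac)
  also have "\<dots> = (\<integral>\<^sup>+z. f (\<i> ^ k * z) \<partial>lborel)"
    by (rule nn_integral_lborel_mult_ii[where f = "\<lambda>z. f (\<i> ^ k * z)"]) measurable
  finally show ?case using Suc.IH by simp
qed simp

text \<open>In the sector around the positive real axis, the point of radius \<open>r\<close> and
  slope \<open>v\<close> is \<open>Complex r (r * v)\<close>. The factor \<open>r\<close> is the
  Jacobian of \<open>y = r * v\<close>, and passing from the sector to the plane only increases the
  integral.\<close>

lemma nn_integral_sector_le:
  assumes [measurable]: "f \<in> borel_measurable borel" and "0 \<le> a"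
  shows "(\<integral>\<^sup>+r. (\<integral>\<^sup>+v. ennreal r * f (of_real r * (1 + \<i> * of_real v)) * indicator {-1..1} v \<partial>lborel)
            * indicator {a<..<b} r \<partial>lborel) \<le> (\<integral>\<^sup>+z. f z \<partial>lborel)"
proof -
  have [measurable]: "Complex x \<in> borel_measurable borel" for x
    by (intro borel_measurable_continuous_onI continuous_intros)
  have "(\<integral>\<^sup>+v. ennreal r * f (of_real r * (1 + \<i> * of_real v)) * indicator {-1..1} v \<partial>lborel) * indicator {a<..<b} r
     \<le> (\<integral>\<^sup>+y. f (Complex r y) \<partial>lborel)" for r
  proof (cases "r \<in> {a<..<b}")
    case True
    with assms(2) have r: "0 < r" by simp
    have "(\<integral>\<^sup>+v. ennreal r * f (of_real r * (1 + \<i> * of_real v)) * indicator {-1..1} v \<partial>lborel)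
       \<le> (\<integral>\<^sup>+v. ennreal r * f (Complex r (0 + r * v)) \<partial>lborel)"
    proof (rule nn_integral_mono)
      fix v :: real
      have "of_real r * (1 + \<i> * of_real v) = Complex r (0 + r * v)"
        by (simp add: complex_eq_iff)
      then show "ennreal r * f (of_real r * (1 + \<i> * of_real v)) * indicator {-1..1} v \<le> ennreal r * f (Complex r (0 + r * v))"
        by (simp split: split_indicator)
    qed
    also have "\<dots> = ennreal r * (\<integral>\<^sup>+v. f (Complex r (0 + r * v)) \<partial>lborel)"
      by (rule nn_integral_cmult) measurable
    also have "\<dots> = (\<integral>\<^sup>+y. f (Complex r y) \<partial>lborel)"
      using r by (subst (2) nn_integral_real_affine[where c = r and t = 0]) auto
    finally show ?thesis using True by simp
  qed simp
  then show ?thesis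
    unfolding nn_integral_lborel_complex[OF assms(1)] by (rule nn_integral_mono)
qed


text \<open>Cauchy-Schwarz on an interval of length \<open>1\<close>, in the form of the pointwise
  inequality \<open>2 * h t \<le> (h t)\<^sup>2 + 1\<close>.\<close>

lemma one_le_nn_integral_power2:
  fixes h :: "real \<Rightarrow> ennreal"
  assumes [measurable]: "h \<in> borel_measurable borel" and "1 \<le> (\<integral>\<^sup>+t. h t * indicator {0..1} t \<partial>lborel)"
  shows "1 \<le> (\<integral>\<^sup>+t. (h t)\<^sup>2 * indicator {0..1} t \<partial>lborel)"
proof -
  have "2 * h t \<le> (h t)\<^sup>2 + 1" for t
  proof (cases "h t")
    case (real x)
    have "2 * x \<le> x\<^sup>2 + 1" using zero_le_power2[of "x - 1"] by (simp add: power2_diff)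
    then have "ennreal (2 * x) \<le> ennreal (x\<^sup>2 + 1)" by (rule ennreal_leI)
    moreover have "2 * h t = ennreal (2 * x)" using real by (simp add: ennreal_mult)
    moreover have "(h t)\<^sup>2 + 1 = ennreal (x\<^sup>2 + 1)" using real by (simp add: ennreal_power)
    ultimately show ?thesis by simp
  qed simp
  then have "2 * (h t * indicator {0..1} t) \<le> (h t)\<^sup>2 * indicator {0..1} t + indicator {0..1} t" for t
    by (simp split: split_indicator)
  then have "(\<integral>\<^sup>+t. 2 * (h t * indicator {0..1} t) \<partial>lborel) \<le>
     (\<integral>\<^sup>+t. (h t)\<^sup>2 * indicator {0..1} t + indicator {0..1} t \<partial>lborel)"
    by (rule nn_integral_mono)
  then have "2 * (\<integral>\<^sup>+t. h t * indicator {0..1} t \<partial>lborel) \<le>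
     (\<integral>\<^sup>+t. (h t)\<^sup>2 * indicator {0..1} t \<partial>lborel) + 1"
    by (simp add: nn_integral_cmult nn_integral_add)
  moreover have "1 + 1 \<le> 2 * (\<integral>\<^sup>+t. h t * indicator {0..1} t \<partial>lborel)"
    using mult_left_mono[OF assms(2), of 2] by simp
  ultimately have "1 + 1 \<le> (\<integral>\<^sup>+t. (h t)\<^sup>2 * indicator {0..1} t \<partial>lborel) + 1"
    by (rule order_trans[rotated])
  then have "1 + 1 \<le> 1 + (\<integral>\<^sup>+t. (h t)\<^sup>2 * indicator {0..1} t \<partial>lborel)"
    by (simp only: add.commute)
  then show ?thesis
    by (simp only: ennreal_add_left_cancel_le) simp
qed

text \<open>The factor \<open>8\<close> undoes the change of variable from time to \<open>v\<close>,
  where time has slope \<open>1 / 8\<close>. The four time intervals share endpoints, so covering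
  \<open>{0..1}\<close> by them yields an inequality.\<close>

lemma nn_integral_square_path_le:
  assumes [measurable]: "f \<in> borel_measurable borel"
  shows "8 * (\<integral>\<^sup>+t. f (square_path r t) * indicator {0..1} t \<partial>lborel) \<le>
     (\<Sum>k<4. \<integral>\<^sup>+v. f (\<i> ^ k * (of_real r * (1 + \<i> * of_real v))) * indicator {-1..1} v \<partial>lborel)"
proof -
  have [measurable]: "square_path r \<in> borel_measurable borel"
    unfolding square_path_def
    by (intro borel_measurable_continuous_onI continuous_intros continuous_on_unit_square_path)
  let ?J = "\<lambda>k. {real k / 4..(real k + 1) / 4}"
  have "indicator {0..1} t \<le> (\<Sum>k<4. indicator (?J k) t :: ennreal)" for t
  proof (cases "t \<in> {0..1}")
    case True
    then obtain k v where "k < 4" "-1 \<le> v" "v \<le> 1" "t = (2 * real k + 1) / 8 + v / 8"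
      by (rule unit_square_path_cases)
    then have "k \<in> {..<4}" "t \<in> ?J k" by (auto simp: field_simps)
    then show ?thesis
      using True member_le_sum[of k "{..<4}" "\<lambda>k. indicator (?J k) t :: ennreal"] by simp
  qed simp
  then have "(\<integral>\<^sup>+t. f (square_path r t) * indicator {0..1} t \<partial>lborel) \<le>
      (\<integral>\<^sup>+t. (\<Sum>k<4. f (square_path r t) * indicator (?J k) t) \<partial>lborel)"
    by (intro nn_integral_mono) (simp add: mult_left_mono flip: sum_distrib_left)
  also have "\<dots> = (\<Sum>k<4. \<integral>\<^sup>+t. f (square_path r t) * indicator (?J k) t \<partial>lborel)"
    by (rule nn_integral_sum) measurable
  finally have "8 * (\<integral>\<^sup>+t. f (square_path r t) * indicator {0..1} t \<partial>lborel) \<le>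
      (\<Sum>k<4. 8 * (\<integral>\<^sup>+t. f (square_path r t) * indicator (?J k) t \<partial>lborel))"
    by (simp add: mult_left_mono flip: sum_distrib_left)
  also have "\<dots> = (\<Sum>k<4. \<integral>\<^sup>+v. f (\<i> ^ k * (of_real r * (1 + \<i> * of_real v))) * indicator {-1..1} v \<partial>lborel)"
  proof (rule sum.cong)
    fix k :: nat assume k: "k \<in> {..<4}"
    let ?t = "\<lambda>v. (2 * real k + 1) / 8 + 1 / 8 * v"
    have "(\<integral>\<^sup>+t. f (square_path r t) * indicator (?J k) t \<partial>lborel) =
      ennreal (1 / 8) * (\<integral>\<^sup>+v. f (square_path r (?t v)) * indicator (?J k) (?t v) \<partial>lborel)"
      by (subst nn_integral_real_affine[where c = "1 / 8" and t = "(2 * real k + 1) / 8"]) auto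
    also have "(\<integral>\<^sup>+v. f (square_path r (?t v)) * indicator (?J k) (?t v) \<partial>lborel) =
      (\<integral>\<^sup>+v. f (\<i> ^ k * (of_real r * (1 + \<i> * of_real v))) * indicator {-1..1} v \<partial>lborel)"
    proof (rule nn_integral_cong)
      fix v :: real
      have "?t v \<in> ?J k \<longleftrightarrow> v \<in> {-1..1}" by (auto simp: field_simps)
      moreover have "square_path r (?t v) = \<i> ^ k * (of_real r * (1 + \<i> * of_real v))" if "v \<in> {-1..1}"
        using that unit_square_path_side[of v k] k by (simp add: square_path_def)
      ultimately show "f (square_path r (?t v)) * indicator (?J k) (?t v) =
         f (\<i> ^ k * (of_real r * (1 + \<i> * of_real v))) * indicator {-1..1} v"
        by (simp split: split_indicator)
    qed
    finally have "8 * (\<integral>\<^sup>+t. f (square_path r t) * indicator (?J k) t \<partial>lborel) =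
      (8 * ennreal (1 / 8)) * (\<integral>\<^sup>+v. f (\<i> ^ k * (of_real r * (1 + \<i> * of_real v))) * indicator {-1..1} v \<partial>lborel)"
      by (simp add: mult.assoc)
    also have "8 * ennreal (1 / 8) = 1"
      using ennreal_mult[of 8 "1 / 8"] by simp
    finally show "8 * (\<integral>\<^sup>+t. f (square_path r t) * indicator (?J k) t \<partial>lborel) =
      (\<integral>\<^sup>+v. f (\<i> ^ k * (of_real r * (1 + \<i> * of_real v))) * indicator {-1..1} v \<partial>lborel)"
      by simp
  qed simp
  finally show ?thesis .
qed

text \<open>Length-area argument: admissibility and Cauchy-Schwarz on the square of radius
  \<open>r\<close> bound \<open>1 / r\<close> by a multiple of the integral of the squared density
  along it, and integration in \<open>r\<close> produces \<open>ln (b / a)\<close>.\<close>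

lemma curve_modulus_square_paths_ge:
  assumes "0 < a" "a \<le> b"
  shows "ennreal (ln (b / a) / 32) \<le> curve_modulus (square_path ` {a<..<b})"
  unfolding curve_modulus_def
proof (rule INF_greatest)
  fix \<rho> :: "complex \<Rightarrow> ennreal" assume "\<rho> \<in> {\<rho>. admissible \<rho> (square_path ` {a<..<b})}"
  then have [measurable]: "\<rho> \<in> borel_measurable borel"
    and adm: "\<And>r. r \<in> {a<..<b} \<Longrightarrow> 1 \<le> line_integral \<rho> (square_path r)"
    using assms rectifiable_square_path by (auto simp: admissible_def)
  let ?S = "\<lambda>k r. \<integral>\<^sup>+v. ennreal r * (\<rho> (\<i> ^ k * (of_real r * (1 + \<i> * of_real v))))\<^sup>2 * indicator {-1..1} v \<partial>lborel"
  have [measurable]: "square_path r \<in> borel_measurable borel" for r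
    unfolding square_path_def
    by (intro borel_measurable_continuous_onI continuous_intros continuous_on_unit_square_path)
  \<comment> \<open>Squaring the speed gives \<open>64 * r * r\<close>: one \<open>8\<close> is
    absorbed by the passage to \<open>v\<close>, one \<open>r\<close> cancels against
    \<open>1 / r\<close>, and the other becomes the Jacobian inside \<open>?S\<close>.\<close>
  have bound: "ennreal (1 / r) \<le> 8 * (\<Sum>k<4. ?S k r)" if "r \<in> {a<..<b}" for r
  proof -
    have r: "0 < r" using that assms by simp
    have "1 \<le> (\<integral>\<^sup>+t. (ennreal (8 * r) * \<rho> (square_path r t))\<^sup>2 * indicator {0..1} t \<partial>lborel)"
      using adm[OF that] r by (intro one_le_nn_integral_power2) (simp_all add: line_integral_square_path)
    also have "\<dots> = (\<integral>\<^sup>+t. ennreal (64 * r * r) * ((\<rho> (square_path r t))\<^sup>2 * indicator {0..1} t) \<partial>lborel)"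
    proof -
      have "(ennreal (8 * r))\<^sup>2 = ennreal (64 * r * r)"
        using r by (simp add: ennreal_power power_mult_distrib) (simp add: power2_eq_square mult.assoc)
      then show ?thesis by (simp only: power_mult_distrib mult.assoc)
    qed
    also have "\<dots> = ennreal (64 * r * r) * (\<integral>\<^sup>+t. (\<rho> (square_path r t))\<^sup>2 * indicator {0..1} t \<partial>lborel)"
      by (rule nn_integral_cmult) measurable
    also have "\<dots> = ennreal (8 * r * r) * (8 * (\<integral>\<^sup>+t. (\<rho> (square_path r t))\<^sup>2 * indicator {0..1} t \<partial>lborel))"
      using r ennreal_mult[of "8 * r * r" 8] by (simp add: mult_ac flip: mult.assoc)
    also have "\<dots> \<le> ennreal (8 * r * r) * (\<Sum>k<4. \<integral>\<^sup>+v. (\<rho> (\<i> ^ k * (of_real r * (1 + \<i> * of_real v))))\<^sup>2 * indicator {-1..1} v \<partial>lborel)"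
      by (intro mult_left_mono nn_integral_square_path_le) auto
    finally have "ennreal (1 / r) * 1 \<le> ennreal (1 / r) * (ennreal (8 * r * r) * (\<Sum>k<4. \<integral>\<^sup>+v. (\<rho> (\<i> ^ k * (of_real r * (1 + \<i> * of_real v))))\<^sup>2 * indicator {-1..1} v \<partial>lborel))"
      by (rule mult_left_mono) simp
    also have "\<dots> = 8 * (ennreal r * (\<Sum>k<4. \<integral>\<^sup>+v. (\<rho> (\<i> ^ k * (of_real r * (1 + \<i> * of_real v))))\<^sup>2 * indicator {-1..1} v \<partial>lborel))"
    proof -
      have "ennreal (1 / r) * ennreal (8 * r * r) = ennreal (8 * r)"
        using r by (simp flip: ennreal_mult)
      also have "\<dots> = 8 * ennreal r"
        using r by (simp add: ennreal_mult)
      finally show ?thesis by (simp flip: mult.assoc)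
    qed
    also have "ennreal r * (\<Sum>k<4. \<integral>\<^sup>+v. (\<rho> (\<i> ^ k * (of_real r * (1 + \<i> * of_real v))))\<^sup>2 * indicator {-1..1} v \<partial>lborel)
       = (\<Sum>k<4. ?S k r)"
      unfolding sum_distrib_left by (intro sum.cong refl) (simp add: mult.assoc nn_integral_cmult)
    finally show ?thesis by simp
  qed
  have "ennreal (ln b - ln a) = (\<integral>\<^sup>+r. ennreal (1 / r) * indicator {a..b} r \<partial>lborel)"
    by (rule nn_integral_FTC_Icc[symmetric]) (use assms in \<open>auto intro!: derivative_eq_intros DERIV_ln_divide\<close>)
  also have "\<dots> = (\<integral>\<^sup>+r. ennreal (1 / r) * indicator {a<..<b} r \<partial>lborel)"
  proof (rule nn_integral_cong_AE)
    show "AE r in lborel. ennreal (1 / r) * indicator {a..b} r = ennreal (1 / r) * indicator {a<..<b} r"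
      using AE_lborel_singleton[of a] AE_lborel_singleton[of b] by eventually_elim (auto split: split_indicator)
  qed
  also have "\<dots> \<le> (\<integral>\<^sup>+r. (8 * (\<Sum>k<4. ?S k r)) * indicator {a<..<b} r \<partial>lborel)"
    by (intro nn_integral_mono) (use bound in \<open>auto split: split_indicator\<close>)
  also have "\<dots> = (\<integral>\<^sup>+r. 8 * (\<Sum>k<4. ?S k r * indicator {a<..<b} r) \<partial>lborel)"
    by (simp add: sum_distrib_right mult.assoc)
  also have "\<dots> = 8 * (\<Sum>k<4. \<integral>\<^sup>+r. ?S k r * indicator {a<..<b} r \<partial>lborel)"
    by (subst nn_integral_cmult, measurable, subst nn_integral_sum, measurable)
  \<comment> \<open>After a rotation each of the four sector integrals is bounded by the integral
    over the whole plane; this is the origin of \<open>32 = 8 * 4\<close>.\<close>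
  also have "\<dots> \<le> 8 * (\<Sum>k<(4::nat). \<integral>\<^sup>+z. (\<rho> z)\<^sup>2 \<partial>lborel)"
  proof (intro mult_left_mono sum_mono)
    fix k :: nat
    have "(\<integral>\<^sup>+r. ?S k r * indicator {a<..<b} r \<partial>lborel) \<le> (\<integral>\<^sup>+z. (\<rho> (\<i> ^ k * z))\<^sup>2 \<partial>lborel)"
      by (rule nn_integral_sector_le[where f = "\<lambda>z. (\<rho> (\<i> ^ k * z))\<^sup>2"]) (use assms in auto)
    also have "\<dots> = (\<integral>\<^sup>+z. (\<rho> z)\<^sup>2 \<partial>lborel)"
      by (rule nn_integral_lborel_mult_ii_power[where f = "\<lambda>z. (\<rho> z)\<^sup>2"]) measurable
    finally show "(\<integral>\<^sup>+r. ?S k r * indicator {a<..<b} r \<partial>lborel) \<le> (\<integral>\<^sup>+z. (\<rho> z)\<^sup>2 \<partial>lborel)" .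
  qed simp
  also have "\<dots> = 32 * (\<integral>\<^sup>+z. (\<rho> z)\<^sup>2 \<partial>lborel)"
    by (simp flip: mult.assoc)
  finally have "ennreal (1 / 32) * ennreal (ln (b / a)) \<le> ennreal (1 / 32) * (32 * (\<integral>\<^sup>+z. (\<rho> z)\<^sup>2 \<partial>lborel))"
    using assms by (intro mult_left_mono) (simp_all add: ln_div)
  also have "ennreal (1 / 32) * (32 * (\<integral>\<^sup>+z. (\<rho> z)\<^sup>2 \<partial>lborel)) = (\<integral>\<^sup>+z. (\<rho> z)\<^sup>2 \<partial>lborel)"
    using ennreal_mult[of "1 / 32" 32] by (simp flip: mult.assoc)
  finally show "ennreal (ln (b / a) / 32) \<le> (\<integral>\<^sup>+z. (\<rho> z)\<^sup>2 \<partial>lborel)"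
    using assms ennreal_mult[of "1 / 32" "ln (b / a)"] by simp
qed

subsection \<open>Complements of totally disconnected sets of reals\<close>

text \<open>The real line has empty interior in the plane: a small vertical shift leaves it.\<close>

lemma open_diff_real_nonempty:
  assumes "open N" "N \<noteq> {}"
  shows "N - complex_of_real ` S \<noteq> {}"
proof -
  obtain z where "z \<in> N" using assms by auto
  then obtain e where e: "0 < e" "ball z e \<subseteq> N" using assms open_contains_ball by blast
  show ?thesis
  proof (cases "Im z = 0")
    case True
    have "z + of_real (e / 2) * \<i> \<in> ball z e"
      using e by (simp add: dist_norm norm_mult)
    moreover have "z + of_real (e / 2) * \<i> \<notin> complex_of_real ` S"
      using True e by (auto simp: complex_eq_iff)
    ultimately show ?thesis using e by blast
  next
    case False
    then have "z \<notin> complex_of_real ` S" by auto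
    then show ?thesis using \<open>z \<in> N\<close> by blast
  qed
qed

text \<open>Each open half disc stays connected when the real points outside \<open>S\<close> are
  added, since these lie in its closure. The two enlarged half discs share a real point because
  \<open>S\<close> leaves a gap to the right of the centre.\<close>

lemma connected_ball_diff_real:
  assumes "\<And>x y. x < y \<Longrightarrow> \<exists>z. x < z \<and> z < y \<and> z \<notin> S" "0 < r"
  shows "connected (ball (complex_of_real x) r - complex_of_real ` S)"
proof -
  let ?B = "ball (complex_of_real x) r"
  define R where "R = {z \<in> ?B. Im z = 0} - complex_of_real ` S"
  have half: "connected (?B \<inter> H \<union> R)"
    if H: "convex H" "\<And>z e. Im z = 0 \<Longrightarrow> 0 < e \<Longrightarrow> \<exists>w \<in> H. dist w z < e" for H
  proof (rule connected_intermediate_closure)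
    show "connected (?B \<inter> H)" by (intro convex_connected convex_Int convex_ball H)
    show "?B \<inter> H \<union> R \<subseteq> closure (?B \<inter> H)"
    proof (intro Un_least closure_subset subsetI)
      fix z assume "z \<in> R"
      then have z: "z \<in> ?B" "Im z = 0" by (auto simp: R_def)
      have "closure H \<inter> ?B \<subseteq> closure (?B \<inter> H)"
        using open_Int_closure_subset[of ?B H] by (simp add: Int_commute)
      moreover have "z \<in> closure H"
        using H(2)[OF z(2)] by (simp add: closure_approachable)
      ultimately show "z \<in> closure (?B \<inter> H)" using z by blast
    qed
  qed simp
  have "\<exists>w \<in> {w. 0 < Im w}. dist w z < e" "\<exists>w \<in> {w. Im w < 0}. dist w z < e" if "Im z = 0" "0 < e" for z e
  proof -
    have "dist (z + of_real (e / 2) * \<i>) z < e" "dist (z - of_real (e / 2) * \<i>) z < e"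
      using that by (simp_all add: dist_norm norm_mult)
    moreover have "0 < Im (z + of_real (e / 2) * \<i>)" "Im (z - of_real (e / 2) * \<i>) < 0"
      using that by simp_all
    ultimately show "\<exists>w \<in> {w. 0 < Im w}. dist w z < e" "\<exists>w \<in> {w. Im w < 0}. dist w z < e"
      by blast+
  qed
  then have "connected (?B \<inter> {w. 0 < Im w} \<union> R)" "connected (?B \<inter> {w. Im w < 0} \<union> R)"
    by (auto intro!: half convex_halfspace_Im_gt convex_halfspace_Im_lt)
  moreover have "(?B \<inter> {w. 0 < Im w} \<union> R) \<inter> (?B \<inter> {w. Im w < 0} \<union> R) \<noteq> {}"
  proof -
    obtain z where "x < z" "z < x + r" "z \<notin> S" using assms(1)[of x "x + r"] assms(2) by auto
    then have "complex_of_real z \<in> R" by (auto simp: R_def dist_norm simp flip: of_real_diff)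
    then show ?thesis by blast
  qed
  ultimately have "connected ((?B \<inter> {w. 0 < Im w} \<union> R) \<union> (?B \<inter> {w. Im w < 0} \<union> R))"
    by (rule connected_Un)
  also have "(?B \<inter> {w. 0 < Im w} \<union> R) \<union> (?B \<inter> {w. Im w < 0} \<union> R) = ?B - complex_of_real ` S"
    by (auto simp: R_def)
  finally show ?thesis .
qed

text \<open>A splitting of \<open>N\<close> minus the set extends to a splitting of
  \<open>N\<close>: every point has a neighbourhood whose part off the set is connected and
  therefore belongs to one side.\<close>

lemma connected_diff_real:
  assumes S: "closed S" "\<And>x y. x < y \<Longrightarrow> \<exists>z. x < z \<and> z < y \<and> z \<notin> S"
    and N: "open N" "connected N"
  shows "connected (N - complex_of_real ` S)"
proof (rule connectedI)
  let ?S = "complex_of_real ` S"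
  have clS: "closed ?S"
    by (intro closed_injective_linear_image S(1) bounded_linear.linear bounded_linear_of_real inj_of_real)
  fix A B assume AB: "open A" "open B" "A \<inter> (N - ?S) \<noteq> {}" "B \<inter> (N - ?S) \<noteq> {}"
    "A \<inter> B \<inter> (N - ?S) = {}" "N - ?S \<subseteq> A \<union> B"
  \<comment> \<open>The largest open subset of \<open>N\<close> that lies in \<open>U\<close> off
    the removed set.\<close>
  define E where "E U = \<Union>{V. open V \<and> V \<subseteq> N \<and> V - ?S \<subseteq> U}" for U
  have op: "open (E U)" for U by (auto simp: E_def)
  have cover: "N \<subseteq> E A \<union> E B"
  proof
    fix x assume x: "x \<in> N"
    have "\<exists>V. open V \<and> x \<in> V \<and> V \<subseteq> N \<and> connected (V - ?S)"
    proof (cases "x \<in> ?S")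
      case True
      then obtain t where t: "x = of_real t" by auto
      obtain e where "0 < e" "ball x e \<subseteq> N" using N(1) x open_contains_ball by blast
      then show ?thesis
        using connected_ball_diff_real[OF S(2)] t by (intro exI[of _ "ball x e"]) auto
    next
      case False
      have "open (N - ?S)" using N(1) clS by (rule open_Diff)
      then obtain e where e: "0 < e" "ball x e \<subseteq> N - ?S" using x False open_contains_ball by blast
      then have "ball x e - ?S = ball x e" by auto
      then show ?thesis using e by (intro exI[of _ "ball x e"]) auto
    qed
    then obtain V where V: "open V" "x \<in> V" "V \<subseteq> N" "connected (V - ?S)" by blast
    have "A \<inter> (V - ?S) = {} \<or> B \<inter> (V - ?S) = {}"
    proof (rule connectedD[OF V(4) AB(1,2)])
      show "A \<inter> B \<inter> (V - ?S) = {}" using V(3) AB(5) by blast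
      show "V - ?S \<subseteq> A \<union> B" using V(3) AB(6) by blast
    qed
    then have "V - ?S \<subseteq> B \<or> V - ?S \<subseteq> A"
      using V(3) AB(6) by blast
    with V(1-3) show "x \<in> E A \<union> E B" unfolding E_def by blast
  qed
  \<comment> \<open>Overlapping neighbourhoods from opposite sides would meet in a nonempty open
    subset of the real line.\<close>
  have disj: "E A \<inter> E B = {}"
  proof (rule ccontr)
    assume "E A \<inter> E B \<noteq> {}"
    then obtain V W where V: "open V" "V \<subseteq> N" "V - ?S \<subseteq> A" and W: "open W" "W - ?S \<subseteq> B" and "V \<inter> W \<noteq> {}"
      unfolding E_def by blast
    then have "V \<inter> W - ?S \<noteq> {}"
      by (intro open_diff_real_nonempty open_Int)
    then show False using AB(5) V(2,3) W(2) by blast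
  qed
  have sub: "E U \<subseteq> N" "E U - ?S \<subseteq> U" for U unfolding E_def by blast+
  have "E A \<inter> N = {} \<or> E B \<inter> N = {}"
    by (rule connectedD[OF N(2) op op]) (use disj cover in blast)+
  then have "N - ?S \<subseteq> B \<or> N - ?S \<subseteq> A" using cover sub(2)[of A] sub(2)[of B] by blast
  then show False using AB(3-5) by blast
qed

text \<open>In the applications the points of the Cantor set are only limit points of the sides
  \<open>A\<close> and \<open>B\<close>, hence the closures; an open \<open>N\<close> that meets the
  closure of a side meets the side itself.\<close>

lemma not_separated:
  assumes "closed S" "\<And>x y. x < y \<Longrightarrow> \<exists>z. x < z \<and> z < y \<and> z \<notin> S"
    and "open N" "connected N" "open A" "open B" "A \<inter> B = {}" "N - complex_of_real ` S \<subseteq> A \<union> B"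
    and "N \<inter> closure A \<noteq> {}" "N \<inter> closure B \<noteq> {}"
  shows False
proof -
  have "N \<inter> A \<noteq> {}" "N \<inter> B \<noteq> {}"
    using assms(9,10) open_Int_closure_eq_empty[OF assms(3)] by blast+
  then have "N \<inter> A - complex_of_real ` S \<noteq> {}" "N \<inter> B - complex_of_real ` S \<noteq> {}"
    using assms(3,5,6) by (simp_all only: open_diff_real_nonempty open_Int not_False_eq_True)
  moreover have "A \<inter> (N - complex_of_real ` S) = {} \<or> B \<inter> (N - complex_of_real ` S) = {}"
    by (rule connectedD[OF connected_diff_real[OF assms(1-4)] assms(5,6)]) (use assms(7,8) in blast)+
  ultimately show False by blast
qed

subsection \<open>Curves separating a uniformly perfect set of reals\<close>

text \<open>The least solution of \<open>f q = r\<close> works: a larger value before it would force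
  an earlier solution.\<close>

lemma first_exit:
  fixes f :: "real \<Rightarrow> real"
  assumes "continuous_on {s..t} f" "f s \<le> r" "r \<le> f t" "s \<le> t"
  shows "\<exists>q\<in>{s..t}. f q = r \<and> (\<forall>u\<in>{s..q}. f u \<le> r)"
proof -
  let ?T = "{u \<in> {s..t}. f u = r}"
  have "closed ?T"
    by (rule continuous_closed_preimage_constant[OF assms(1)]) simp
  moreover have "bounded ?T"
    by (rule bounded_subset[OF bounded_closed_interval[of s t]]) auto
  ultimately have "compact ?T"
    by (simp add: compact_eq_bounded_closed)
  moreover have "?T \<noteq> {}"
    using IVT'[of f s r t, OF assms(2-4,1)] by auto
  ultimately have "\<exists>q\<in>?T. \<forall>u\<in>?T. q \<le> u"
    by (rule compact_attains_inf)
  then obtain q where q: "q \<in> {s..t}" "f q = r" and min: "\<And>u. u \<in> {s..t} \<Longrightarrow> f u = r \<Longrightarrow> q \<le> u"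
    by blast
  have "f u \<le> r" if u: "s \<le> u" "u \<le> q" for u
  proof (rule ccontr)
    assume neg: "\<not> f u \<le> r"
    have "continuous_on {s..u} f"
      by (rule continuous_on_subset[OF assms(1)]) (use u q in auto)
    then obtain v where v: "s \<le> v" "v \<le> u" "f v = r"
      using IVT'[of f s r u] neg assms(2) u(1) by (meson le_cases)
    then have "q \<le> v" using min[of v] u q(1) by simp
    with u v have "v = u" by simp
    with v neg show False by simp
  qed
  with q show ?thesis by (intro bexI[of _ q]) simp_all
qed

lemma subarc_in_cball:
  assumes "path \<gamma>" "s \<in> {0..1}" "t \<in> {0..1}" "r \<le> dist (\<gamma> s) (\<gamma> t)" "0 \<le> r"
  obtains p q where "0 \<le> p" "p \<le> q" "q \<le> 1" "dist (\<gamma> p) (\<gamma> q) = r" "\<And>u. u \<in> {p..q} \<Longrightarrow> \<gamma> u \<in> cball (\<gamma> s) r"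
proof (cases "s \<le> t")
  case True
  have "continuous_on {s..t} (\<lambda>u. dist (\<gamma> s) (\<gamma> u))"
    by (intro continuous_on_dist continuous_on_const continuous_on_subset[OF assms(1)[unfolded path_def]])
       (use assms(2,3) in simp)
  from first_exit[OF this, of r] True assms(4,5) obtain q where q: "q \<in> {s..t}" "dist (\<gamma> s) (\<gamma> q) = r"
    and le: "\<And>u. u \<in> {s..q} \<Longrightarrow> dist (\<gamma> s) (\<gamma> u) \<le> r" by (metis dist_self)
  show ?thesis
  proof (rule that[of s q])
    show "\<gamma> u \<in> cball (\<gamma> s) r" if "u \<in> {s..q}" for u
      using le[OF that] by simp
  qed (use q assms(2,3) in simp_all)
next
  case False
  \<comment> \<open>Here \<open>t\<close> precedes \<open>s\<close>; negating the parameter reduces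
    this case to the same exit argument.\<close>
  have "continuous_on {-s..-t} (\<lambda>u. dist (\<gamma> s) (\<gamma> (- u)))"
    by (intro continuous_on_dist continuous_on_const continuous_on_compose2[OF assms(1)[unfolded path_def]]
         continuous_on_minus continuous_on_id)
       (use assms(2,3) in auto)
  from first_exit[OF this, of r] False assms(4,5) obtain q where q: "q \<in> {-s..-t}" "dist (\<gamma> s) (\<gamma> (- q)) = r"
    and le: "\<And>u. u \<in> {-s..q} \<Longrightarrow> dist (\<gamma> s) (\<gamma> (- u)) \<le> r"
    by (metis add.inverse_inverse dist_self linear neg_le_iff_le)
  show ?thesis
  proof (rule that[of "- q" s])
    show "\<gamma> u \<in> cball (\<gamma> s) r" if "u \<in> {- q..s}" for u
      using le[of "- u"] that by simp
  qed (use q assms(2,3) in \<open>simp_all add: dist_commute\<close>)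
qed

lemma emeasure_cball_le:
  fixes a :: complex
  assumes "0 \<le> r"
  shows "emeasure lborel (cball a r) \<le> ennreal (4 * r\<^sup>2)"
proof -
  have "cball a r \<subseteq> cbox (a - Complex r r) (a + Complex r r)"
  proof
    fix z assume "z \<in> cball a r"
    then have "cmod (a - z) \<le> r" by (simp add: dist_norm)
    with abs_Re_le_cmod[of "a - z"] abs_Im_le_cmod[of "a - z"]
    show "z \<in> cbox (a - Complex r r) (a + Complex r r)"
      by (auto simp: in_cbox_complex_iff abs_le_iff)
  qed
  then have "emeasure lborel (cball a r) \<le> emeasure lborel (cbox (a - Complex r r) (a + Complex r r))"
    by (rule emeasure_mono) simp
  also have "\<dots> = ennreal (4 * r\<^sup>2)"
    using assms by (subst emeasure_lborel_cbox) (auto simp: Basis_complex_def inner_complex_def power2_eq_square)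
  finally show ?thesis .
qed

text \<open>Between its visit to \<open>x\<close> and the boundary of \<open>cball x r\<close> the
  curve has length at least \<open>r\<close>, and there the density is \<open>1 / r\<close>.\<close>

lemma one_le_line_integral:
  assumes \<gamma>: "path \<gamma>" "rectifiable \<gamma>" and "0 < r" and x: "x \<in> path_image \<gamma>" and "\<not> path_image \<gamma> \<subseteq> cball x r"
    and "cball x r \<subseteq> B" and [measurable]: "B \<in> sets borel"
  shows "1 \<le> line_integral (\<lambda>z. ennreal (1 / r) * indicator B z) \<gamma>"
proof -
  obtain s where s: "s \<in> {0..1}" "x = \<gamma> s" using x by (auto simp: path_image_def)
  obtain t where t: "t \<in> {0..1}" "r \<le> dist (\<gamma> s) (\<gamma> t)"
    using assms(5) s(2) by (auto simp: path_image_def image_subset_iff not_le intro: less_imp_le)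
  obtain p q where pq: "0 \<le> p" "p \<le> q" "q \<le> 1" "dist (\<gamma> p) (\<gamma> q) = r"
    and ball: "\<And>u. u \<in> {p..q} \<Longrightarrow> \<gamma> u \<in> cball (\<gamma> s) r"
    using subarc_in_cball[OF \<gamma>(1) s(1) t] \<open>0 < r\<close> by (metis less_imp_le)
  let ?\<mu> = "arc_length_measure \<gamma>"
  have "r \<le> arc_length \<gamma> q - arc_length \<gamma> p"
    using dist_le_arc_length[OF \<gamma>(2) pq(1-3)] pq(4) by simp
  then have "ennreal (1 / r) * ennreal r \<le> ennreal (1 / r) * emeasure ?\<mu> {p<..q}"
    using pq by (intro mult_left_mono) (simp_all add: emeasure_arc_length_measure \<gamma> ennreal_leI)
  moreover have "ennreal (1 / r) * ennreal r = 1"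
    using \<open>0 < r\<close> by (simp flip: ennreal_mult)
  moreover have "ennreal (1 / r) * emeasure ?\<mu> {p<..q} = (\<integral>\<^sup>+t. ennreal (1 / r) * indicator {p<..q} t \<partial>?\<mu>)"
    by (rule nn_integral_cmult_indicator[symmetric]) (simp add: arc_length_measure_eq)
  moreover have "\<dots> \<le> line_integral (\<lambda>z. ennreal (1 / r) * indicator B z) \<gamma>"
    unfolding line_integral_def
  proof (rule nn_integral_mono)
    fix t
    show "ennreal (1 / r) * indicator {p<..q} t \<le> ennreal (1 / r) * indicator B (\<gamma> t) * indicator {0..1} t"
      using ball[of t] assms(6) pq s(2) by (auto split: split_indicator)
  qed
  ultimately show ?thesis by simp
qed

text \<open>\<open>2704\<close> is \<open>13\<^sup>2 * 4 * 2\<^sup>2\<close>: the squared density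
  \<open>(13 / d)\<^sup>2\<close> times the area of the square around the disc of radius
  \<open>2 * d\<close>. The scale \<open>d\<close> cancels, so the bound does not depend on how the
  set is split.\<close>

lemma curve_modulus_separating_le:
  fixes S :: "real set"
  assumes S: "closed S" "\<And>x y. x < y \<Longrightarrow> \<exists>z. x < z \<and> z < y \<and> z \<notin> S" "S \<subseteq> {0..1}"
    and perfect: "\<And>x d. x \<in> S \<Longrightarrow> 0 < d \<Longrightarrow> d \<le> 1 \<Longrightarrow> \<exists>y\<in>S. d / 6 \<le> \<bar>x - y\<bar> \<and> \<bar>x - y\<bar> < d"
    and C: "closed C1" "closed C2" "C1 \<union> C2 = complex_of_real ` S" "C1 \<inter> C2 = {}" "C1 \<noteq> {}" "C2 \<noteq> {}"
    and \<Gamma>: "\<And>\<gamma>. \<gamma> \<in> \<Gamma> \<Longrightarrow> path \<gamma> \<and> (\<exists>A B. open A \<and> open B \<and> A \<inter> B = {} \<and>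
              - complex_of_real ` S \<subseteq> A \<union> B \<union> path_image \<gamma> \<and> C1 \<subseteq> closure A \<and> C2 \<subseteq> closure B)"
  shows "curve_modulus \<Gamma> \<le> 2704"
proof -
  have "bounded (complex_of_real ` S)"
    using S(3) by (intro bounded_linear_image[OF _ bounded_linear_of_real] bounded_subset[OF bounded_closed_interval])
  then have "bounded C1" "bounded C2" using C(3) by (metis Un_upper1 Un_upper2 bounded_subset)+
  then have "compact C1" "compact C2" using C by (auto simp: compact_eq_bounded_closed)
  obtain a b where ab: "a \<in> C1" "b \<in> C2" "dist a b = setdist C1 C2"
    using setdist_compact_closed[OF \<open>compact C1\<close> C(2,5,6)] by blast
  then have min: "dist a b \<le> dist x y" if "x \<in> C1" "y \<in> C2" for x y
    using setdist_le_dist[OF that] by simp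
  define d where "d = dist a b"
  have "a \<noteq> b" using ab C(4) by auto
  then have "0 < d" by (simp add: d_def)
  obtain a0 b0 where a0: "a0 \<in> S" "a = of_real a0" and b0: "b0 \<in> S" "b = of_real b0"
    using ab C(3) by blast
  have d0: "d = \<bar>a0 - b0\<bar>"
    by (simp add: d_def a0 b0 dist_norm flip: of_real_diff)
  then have "d \<le> 1" using subsetD[OF S(3) a0(1)] subsetD[OF S(3) b0(1)] by (auto simp: abs_le_iff)
  \<comment> \<open>A point of \<open>S\<close> closer to \<open>a\<close> than \<open>d\<close>
    cannot lie in \<open>C2\<close>, so uniform perfectness at scale \<open>d\<close> supplies a
    second point of the same piece.\<close>
  obtain a' where a': "a' \<in> C1" "d / 6 \<le> dist a a'"
  proof -
    obtain y where "y \<in> S" "d / 6 \<le> \<bar>a0 - y\<bar>" "\<bar>a0 - y\<bar> < d"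
      using perfect[OF a0(1) \<open>0 < d\<close> \<open>d \<le> 1\<close>] by auto
    moreover have "dist a (of_real y) = \<bar>a0 - y\<bar>"
      by (simp add: a0 dist_norm flip: of_real_diff)
    ultimately show ?thesis
      using that[of "of_real y"] C(3) min[OF ab(1), of "of_real y"] by (auto simp: d_def)
  qed
  obtain b' where b': "b' \<in> C2" "d / 6 \<le> dist b b'"
  proof -
    obtain y where "y \<in> S" "d / 6 \<le> \<bar>b0 - y\<bar>" "\<bar>b0 - y\<bar> < d"
      using perfect[OF b0(1) \<open>0 < d\<close> \<open>d \<le> 1\<close>] by auto
    moreover have "dist b (of_real y) = \<bar>b0 - y\<bar>"
      by (simp add: b0 dist_norm flip: of_real_diff)
    ultimately show ?thesis
      using that[of "of_real y"] C(3) min[OF _ ab(2), of "of_real y"] by (auto simp: d_def dist_commute)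
  qed
  \<comment> \<open>Any divisor above \<open>12\<close> makes the ball too small for two points at
    distance \<open>d / 6\<close>.\<close>
  define r where "r = d / 13"
  have "0 < r" using \<open>0 < d\<close> by (simp add: r_def)
  define \<rho> where "\<rho> z = ennreal (1 / r) * indicator (cball a (2 * d)) z" for z
  have "admissible \<rho> \<Gamma>"
    unfolding admissible_def
  proof (intro conjI ballI impI)
    have [measurable]: "cball a (2 * d) \<in> sets borel" by simp
    show "\<rho> \<in> borel_measurable borel" unfolding \<rho>_def by measurable
    fix \<gamma> assume "\<gamma> \<in> \<Gamma>" "rectifiable \<gamma>"
    from \<Gamma>[OF \<open>\<gamma> \<in> \<Gamma>\<close>] obtain A B where \<gamma>: "path \<gamma>" and AB: "open A" "open B" "A \<inter> B = {}"
       "- complex_of_real ` S \<subseteq> A \<union> B \<union> path_image \<gamma>" "C1 \<subseteq> closure A" "C2 \<subseteq> closure B"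
      by blast
    have sep: False if N: "open N" "connected N" "N \<inter> path_image \<gamma> = {}" "N \<inter> C1 \<noteq> {}" "N \<inter> C2 \<noteq> {}" for N
    proof (rule not_separated[OF S(1,2) N(1,2) AB(1-3)])
      show "N - complex_of_real ` S \<subseteq> A \<union> B" using N(3) AB(4) by blast
      show "N \<inter> closure A \<noteq> {}" using N(4) AB(5) by blast
      show "N \<inter> closure B \<noteq> {}" using N(5) AB(6) by blast
    qed
    have "closed_segment a b \<inter> path_image \<gamma> \<noteq> {}"
    proof
      assume disj: "closed_segment a b \<inter> path_image \<gamma> = {}"
      \<comment> \<open>If the curve missed the segment, this component would be an open connected
        set meeting both pieces but not the curve.\<close>
      let ?N = "connected_component_set (- path_image \<gamma>) a"
      have "closed_segment a b \<subseteq> ?N"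
        by (rule connected_component_maximal) (use disj in auto)
      then have "a \<in> ?N" "b \<in> ?N" by auto
      moreover have "open ?N"
        by (intro open_connected_component open_Compl closed_path_image \<gamma>)
      ultimately show False
        using sep[of ?N] ab(1,2) connected_component_subset[of "- path_image \<gamma>" a]
          connected_connected_component[of "- path_image \<gamma>" a] by blast
    qed
    then obtain x where x: "x \<in> closed_segment a b" "x \<in> path_image \<gamma>" by auto
    have "\<not> path_image \<gamma> \<subseteq> cball x r"
    proof
      assume sub: "path_image \<gamma> \<subseteq> cball x r"
      \<comment> \<open>A curve inside the ball would miss this connected set, which contains a
        point of each piece.\<close>
      have "connected (- cball x r)"
        by (rule connected_complement_bounded_convex) auto
      have far: "u \<notin> cball x r \<or> v \<notin> cball x r" if "d / 6 \<le> dist u v" for u v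
      proof (rule ccontr)
        assume "\<not> ?thesis"
        then have "dist u v \<le> 2 * r"
          using dist_triangle3[of u v x] by auto
        with that \<open>0 < d\<close> show False by (simp add: r_def)
      qed
      have "- cball x r \<inter> C1 \<noteq> {}" "- cball x r \<inter> C2 \<noteq> {}"
        using far[OF a'(2)] far[OF b'(2)] ab(1,2) a'(1) b'(1) by blast+
      with \<open>connected (- cball x r)\<close> sub show False
        by (intro sep[of "- cball x r"]) auto
    qed
    \<comment> \<open>The segment stays within \<open>d\<close> of \<open>a\<close>, and
      \<open>d + d / 13 \<le> 2 * d\<close>.\<close>
    moreover have "cball x r \<subseteq> cball a (2 * d)"
    proof -
      have "dist a x \<le> d"
        using dist_in_closed_segment[OF x(1)] by (simp add: d_def dist_commute)
      then show ?thesis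
        using \<open>0 < d\<close> by (intro cball_subset_cball_iff[THEN iffD2] disjI1) (simp add: r_def dist_commute)
    qed
    ultimately show "1 \<le> line_integral \<rho> \<gamma>"
      unfolding \<rho>_def using \<gamma> \<open>rectifiable \<gamma>\<close> \<open>0 < r\<close> x(2) by (intro one_le_line_integral[of _ r x]) auto
  qed
  then have "curve_modulus \<Gamma> \<le> (\<integral>\<^sup>+z. (\<rho> z)\<^sup>2 \<partial>lborel)"
    unfolding curve_modulus_def by (intro INF_lower) simp
  also have "\<dots> = (\<integral>\<^sup>+z. ennreal ((1 / r)\<^sup>2) * indicator (cball a (2 * d)) z \<partial>lborel)"
    using \<open>0 < r\<close> by (intro nn_integral_cong) (simp add: \<rho>_def power_mult_distrib ennreal_power split: split_indicator)
  also have "\<dots> = ennreal ((1 / r)\<^sup>2) * emeasure lborel (cball a (2 * d))"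
    by (rule nn_integral_cmult_indicator) simp
  also have "\<dots> \<le> ennreal ((1 / r)\<^sup>2) * ennreal (4 * (2 * d)\<^sup>2)"
    using \<open>0 < d\<close> by (intro mult_left_mono emeasure_cball_le) auto
  also have "\<dots> = ennreal ((1 / r)\<^sup>2 * (4 * (2 * d)\<^sup>2))"
    by (rule ennreal_mult[symmetric]) auto
  also have "(1 / r)\<^sup>2 * (4 * (2 * d)\<^sup>2) = 2704"
    using \<open>0 < d\<close> by (simp add: r_def power2_eq_square)
  finally show ?thesis by simp
qed

subsection \<open>Intervals and gaps of the Cantor sets\<close>

lemma finite_cantor_intervals: "finite (cantor_intervals q k)"
  by (induction k) auto

lemma card_cantor_intervals: "card (cantor_intervals q k) \<le> 2 ^ k"
proof (induction k)
  case (Suc k)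
  let ?f = "\<lambda>(a, b). {(a, (a + b) / 2 - q (Suc k) * (b - a) / 2), ((a + b) / 2 + q (Suc k) * (b - a) / 2, b)}"
  have "card (cantor_intervals q (Suc k)) \<le> (\<Sum>p\<in>cantor_intervals q k. card (?f p))"
    unfolding cantor_intervals.simps by (rule card_UN_le[OF finite_cantor_intervals])
  also have "\<dots> \<le> (\<Sum>p\<in>cantor_intervals q k. 2)"
    by (intro sum_mono) (auto simp: card_insert_if)
  also have "\<dots> \<le> 2 ^ Suc k" using Suc by simp
  finally show ?case .
qed simp

text \<open>Serves both for the given ratios and for the constant ratio
  \<open>1 / 3\<close>.\<close>

locale cantor_ratios =
  fixes q :: "nat \<Rightarrow> real"
  assumes ratio: "1 \<le> n \<Longrightarrow> 0 < q n \<and> q n < 1"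
begin

lemma child_length:
  fixes a b :: real
  assumes "a < b"
  shows "0 < (b - a) * (1 - q (Suc k)) / 2" "(b - a) * (1 - q (Suc k)) / 2 < (b - a) / 2"
proof -
  have "0 < 1 - q (Suc k)" "1 - q (Suc k) < 1" using ratio[of "Suc k"] by auto
  with assms show "0 < (b - a) * (1 - q (Suc k)) / 2" "(b - a) * (1 - q (Suc k)) / 2 < (b - a) / 2"
    using mult_strict_left_mono[of "1 - q (Suc k)" 1 "b - a"] by auto
qed

lemma cantor_intervals_SucI:
  assumes "(a, b) \<in> cantor_intervals q k"
  shows "(a, a + (b - a) * (1 - q (Suc k)) / 2) \<in> cantor_intervals q (Suc k)"
    "(b - (b - a) * (1 - q (Suc k)) / 2, b) \<in> cantor_intervals q (Suc k)"
  by (auto intro!: bexI[OF _ assms] simp: field_simps)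

text \<open>The bounds on \<open>l\<close> are conditional on \<open>a < b\<close> because that
  inequality is itself proved by induction from this rule.\<close>

lemma cantor_intervals_Suc_cases:
  assumes "(u, v) \<in> cantor_intervals q (Suc k)"
  obtains a b l where "(a, b) \<in> cantor_intervals q k" "l = (b - a) * (1 - q (Suc k)) / 2"
    "(u, v) = (a, a + l) \<or> (u, v) = (b - l, b)" "a < b \<longrightarrow> 0 < l \<and> l < (b - a) / 2"
proof -
  from assms obtain a b where "(a, b) \<in> cantor_intervals q k"
    "(u, v) = (a, a + (b - a) * (1 - q (Suc k)) / 2) \<or> (u, v) = (b - (b - a) * (1 - q (Suc k)) / 2, b)"
    by (auto simp: field_simps)
  then show ?thesis using child_length[of a b k] by (intro that[OF _ refl]) auto
qed

lemma cantor_intervals_bounds: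
  "(a, b) \<in> cantor_intervals q k \<Longrightarrow> a < b \<and> 0 \<le> a \<and> b \<le> 1"
proof (induction k arbitrary: a b)
  case (Suc k)
  from Suc.prems obtain u v l where uv: "(u, v) \<in> cantor_intervals q k"
    and "l = (v - u) * (1 - q (Suc k)) / 2"
    and l: "(a, b) = (u, u + l) \<or> (a, b) = (v - l, v)" "u < v \<longrightarrow> 0 < l \<and> l < (v - u) / 2"
    by (rule cantor_intervals_Suc_cases)
  from Suc.IH[OF uv(1)] l show ?case by auto
qed simp

lemma cantor_stage_Suc_subset: "cantor_stage q (Suc k) \<subseteq> cantor_stage q k"
proof
  fix x assume "x \<in> cantor_stage q (Suc k)"
  then obtain u v where "(u, v) \<in> cantor_intervals q (Suc k)" and x: "x \<in> {u..v}"
    by (auto simp only: cantor_stage_def)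
  from this(1) obtain a b l where ab: "(a, b) \<in> cantor_intervals q k"
    and "l = (b - a) * (1 - q (Suc k)) / 2"
    and l: "(u, v) = (a, a + l) \<or> (u, v) = (b - l, b)" "a < b \<longrightarrow> 0 < l \<and> l < (b - a) / 2"
    by (rule cantor_intervals_Suc_cases)
  from l cantor_intervals_bounds[OF ab(1)] x have "x \<in> {a..b}" by auto
  with ab(1) show "x \<in> cantor_stage q k" unfolding cantor_stage_def by blast
qed

lemma cantor_stage_antimono: "j \<le> k \<Longrightarrow> cantor_stage q k \<subseteq> cantor_stage q j"
  by (rule lift_Suc_antimono_le[of "cantor_stage q"]) (use cantor_stage_Suc_subset in auto)

text \<open>The intersection starts at stage \<open>1\<close>; going through stage
  \<open>k + 1\<close> covers stage \<open>0\<close> as well.\<close>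

lemma random_cantor_set_subset: "random_cantor_set q \<subseteq> cantor_stage q k"
proof -
  have "random_cantor_set q \<subseteq> cantor_stage q (Suc k)"
    by (auto simp: random_cantor_set_def)
  with cantor_stage_Suc_subset show ?thesis by blast
qed

lemma random_cantor_set_subset_unit: "random_cantor_set q \<subseteq> {0..1}"
  using random_cantor_set_subset[of 0] by (simp add: cantor_stage_def)

lemma closed_random_cantor_set: "closed (random_cantor_set q)"
proof -
  have "closed (cantor_stage q k)" for k
    unfolding cantor_stage_def by (intro closed_UN finite_cantor_intervals) auto
  then show ?thesis unfolding random_cantor_set_def by (intro closed_INT) auto
qed

lemma cantor_intervals_persist:
  assumes "(a, b) \<in> cantor_intervals q k"
  shows "\<exists>v. (a, v) \<in> cantor_intervals q (k + n)" "\<exists>u. (u, b) \<in> cantor_intervals q (k + n)"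
proof (induction n)
  case (Suc n)
  { case 1 show ?case using Suc(1) cantor_intervals_SucI(1) by fastforce }
  { case 2 show ?case using Suc(2) cantor_intervals_SucI(2) by fastforce }
qed (use assms in auto)

lemma endpoints_in_random_cantor_set:
  assumes "(a, b) \<in> cantor_intervals q k"
  shows "a \<in> random_cantor_set q" "b \<in> random_cantor_set q"
proof -
  have "a \<in> cantor_stage q n \<and> b \<in> cantor_stage q n" for n
  proof -
    obtain u v where v: "(a, v) \<in> cantor_intervals q (k + n)" and u: "(u, b) \<in> cantor_intervals q (k + n)"
      using cantor_intervals_persist[OF assms] by blast
    have "a \<in> {a..v}" "b \<in> {u..b}"
      using cantor_intervals_bounds[OF v] cantor_intervals_bounds[OF u] by simp_all
    with u v have "a \<in> cantor_stage q (k + n)" "b \<in> cantor_stage q (k + n)"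
      unfolding cantor_stage_def by blast+
    with cantor_stage_antimono[of n "k + n"] show ?thesis by auto
  qed
  then show "a \<in> random_cantor_set q" "b \<in> random_cantor_set q"
    unfolding random_cantor_set_def by blast+
qed

lemma zero_one_in_random_cantor_set: "0 \<in> random_cantor_set q" "1 \<in> random_cantor_set q"
  using endpoints_in_random_cantor_set[of 0 1 0] by auto

text \<open>This product is the length \<open>b k\<close> of the overview.\<close>

definition first_length :: "nat \<Rightarrow> real" where
  "first_length k = (\<Prod>j=1..k. (1 - q j) / 2)"

lemma first_length_Suc: "first_length (Suc k) = first_length k * (1 - q (Suc k)) / 2"
  by (simp add: first_length_def)

lemma first_length_pos: "0 < first_length k"
  unfolding first_length_def by (intro prod_pos) (use ratio in auto)

lemma first_length_le_1: "first_length k \<le> 1"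
  unfolding first_length_def by (intro prod_le_1) (use ratio in \<open>force intro: less_imp_le\<close>)

lemma first_length_Suc_less: "first_length (Suc k) < first_length k / 2"
  using child_length(2)[OF first_length_pos, of k k] by (simp add: first_length_Suc)

text \<open>Children are shorter than half their parent, so the sibling of the leftmost child begins
  to the right of that child.\<close>

lemma first_interval:
  "(a, b) \<in> cantor_intervals q k \<Longrightarrow> (a, b) = (0, first_length k) \<or> first_length k \<le> a"
proof (induction k arbitrary: a b)
  case 0
  then show ?case by (simp add: first_length_def)
next
  case (Suc k)
  from Suc.prems obtain u v l where uv: "(u, v) \<in> cantor_intervals q k"
    and l: "l = (v - u) * (1 - q (Suc k)) / 2"
    and ab: "(a, b) = (u, u + l) \<or> (a, b) = (v - l, v)" "u < v \<longrightarrow> 0 < l \<and> l < (v - u) / 2"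
    by (rule cantor_intervals_Suc_cases)
  have "l = first_length (Suc k)" if "(u, v) = (0, first_length k)"
    using that by (simp add: l first_length_Suc)
  with Suc.IH[OF uv] ab cantor_intervals_bounds[OF uv]
    first_length_Suc_less[of k] first_length_pos[of k]
  show ?case by auto
qed

text \<open>The sibling of the leftmost interval of stage \<open>k + 1\<close> begins at
  \<open>first_length k - first_length (Suc k)\<close>, beyond the midpoint of the parent; the
  descendants of other intervals of stage \<open>k\<close> begin no earlier than
  \<open>first_length k\<close>.\<close>

lemma random_cantor_set_gap:
  assumes "x \<in> random_cantor_set q" "first_length (Suc k) < x"
  shows "first_length k / 2 < x"
proof -
  obtain a b where "(a, b) \<in> cantor_intervals q (Suc k)" and x: "x \<in> {a..b}"
    using assms(1) random_cantor_set_subset[of "Suc k"] by (auto simp only: cantor_stage_def)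
  from this(1) obtain u v l where uv: "(u, v) \<in> cantor_intervals q k"
    and l: "l = (v - u) * (1 - q (Suc k)) / 2"
    and ab: "(a, b) = (u, u + l) \<or> (a, b) = (v - l, v)" "u < v \<longrightarrow> 0 < l \<and> l < (v - u) / 2"
    by (rule cantor_intervals_Suc_cases)
  have "l = first_length (Suc k)" if "(u, v) = (0, first_length k)"
    using that by (simp add: l first_length_Suc)
  with first_interval[OF uv] ab cantor_intervals_bounds[OF uv]
    first_length_Suc_less[of k] first_length_pos[of k] x assms(2)
  show ?thesis by auto
qed

end

section \<open>The middle third Cantor set: empty interior and uniform perfectness\<close>

interpretation third: cantor_ratios "\<lambda>_. 1 / 3"
  by unfold_locales auto

lemma length_third_intervals:
  "(a, b) \<in> cantor_intervals (\<lambda>_. 1 / 3) k \<Longrightarrow> b - a = (1 / 3) ^ k"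
proof (induction k arbitrary: a b)
  case (Suc k)
  from Suc.prems obtain u v l where uv: "(u, v) \<in> cantor_intervals (\<lambda>_. 1 / 3) k"
    "l = (v - u) * (1 - 1 / 3) / 2" "(a, b) = (u, u + l) \<or> (a, b) = (v - l, v)"
    by (rule third.cantor_intervals_Suc_cases)
  with Suc.IH[OF uv(1)] show ?case by auto
qed simp

text \<open>Stage \<open>k\<close> has measure at most \<open>(2 / 3) ^ k\<close>, which leaves no
  room for an interval.\<close>

lemma middle_third_cantor_set_gap:
  assumes "x < y"
  shows "\<exists>z. x < z \<and> z < y \<and> z \<notin> middle_third_cantor_set"
proof (rule ccontr)
  assume "\<not> ?thesis"
  then have sub: "{x<..<y} \<subseteq> middle_third_cantor_set" by auto
  have "y - x \<le> (2 / 3) ^ k" for k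
  proof -
    let ?I = "cantor_intervals (\<lambda>_. 1 / 3) k"
    have "{x<..<y} \<subseteq> (\<Union>(a, b)\<in>?I. {a..b})"
      using sub third.random_cantor_set_subset[of k]
      unfolding middle_third_cantor_set_def cantor_stage_def by blast
    then have "emeasure lborel {x<..<y} \<le> emeasure lborel (\<Union>(a, b)\<in>?I. {a..b})"
      by (rule emeasure_mono) (simp add: sets.finite_UN finite_cantor_intervals case_prod_unfold)
    also have "\<dots> \<le> (\<Sum>p\<in>?I. emeasure lborel (case p of (a, b) \<Rightarrow> {a..b}))"
      by (intro emeasure_subadditive_finite finite_cantor_intervals) auto
    also have "\<dots> = (\<Sum>p\<in>?I. ennreal ((1 / 3) ^ k))"
    proof (intro sum.cong refl)
      fix p assume "p \<in> ?I"
      then show "emeasure lborel (case p of (a, b) \<Rightarrow> {a..b}) = ennreal ((1 / 3) ^ k)"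
        using length_third_intervals[of "fst p" "snd p" k] third.cantor_intervals_bounds[of "fst p" "snd p" k]
        by (auto simp: case_prod_unfold)
    qed
    also have "\<dots> = ennreal (real (card ?I) * (1 / 3) ^ k)"
      by (simp add: ennreal_mult ennreal_of_nat_eq_real_of_nat)
    also have "\<dots> \<le> ennreal (2 ^ k * (1 / 3) ^ k)"
    proof (intro ennreal_leI mult_right_mono)
      show "real (card ?I) \<le> 2 ^ k"
        using of_nat_mono[OF card_cantor_intervals[of "\<lambda>_. 1 / 3" k], where 'a = real] by simp
    qed simp
    also have "2 ^ k * (1 / 3) ^ k = (2 / 3 :: real) ^ k"
      by (simp flip: power_mult_distrib)
    finally show ?thesis
      using assms by (simp add: ennreal_le_iff)
  qed
  moreover obtain k where "(2 / 3 :: real) ^ k < y - x"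
    using real_arch_pow_inv[of "y - x" "2 / 3"] assms by auto
  ultimately show False by (meson not_le)
qed

text \<open>At the stage whose intervals have length at least \<open>d / 3\<close> but below
  \<open>d\<close>, both endpoints of the interval around \<open>x\<close> belong to the set, and
  the farther one is at least half the length away. Hence the \<open>6\<close>.\<close>

lemma middle_third_cantor_set_uniformly_perfect:
  assumes "x \<in> middle_third_cantor_set" "0 < d" "d \<le> 1"
  shows "\<exists>y\<in>middle_third_cantor_set. d / 6 \<le> \<bar>x - y\<bar> \<and> \<bar>x - y\<bar> < d"
proof -
  define k where "k = (LEAST k. (1 / 3 :: real) ^ k < d)"
  have "\<exists>k. (1 / 3 :: real) ^ k < d"
    using real_arch_pow_inv[of d "1 / 3"] assms by auto
  then have k: "(1 / 3 :: real) ^ k < d"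
    unfolding k_def by (rule LeastI_ex)
  \<comment> \<open>\<open>d \<le> 1\<close> excludes \<open>k = 0\<close>, so minimality applies to
    the predecessor of \<open>k\<close> and gives the lower bound on the length.\<close>
  have "k \<noteq> 0" using k assms(3) by (intro notI) simp
  then obtain m where m: "k = Suc m" using not0_implies_Suc by blast
  have "\<not> (1 / 3 :: real) ^ m < d"
    using not_less_Least[of m "\<lambda>k. (1 / 3 :: real) ^ k < d"] by (simp add: m flip: k_def)
  then have k': "d / 3 \<le> (1 / 3) ^ k" by (simp add: m)
  obtain a b where ab: "(a, b) \<in> cantor_intervals (\<lambda>_. 1 / 3) k" and x: "x \<in> {a..b}"
    using assms(1) third.random_cantor_set_subset[of k]
    unfolding middle_third_cantor_set_def cantor_stage_def by blast
  have "a \<in> middle_third_cantor_set" "b \<in> middle_third_cantor_set"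
    unfolding middle_third_cantor_set_def using third.endpoints_in_random_cantor_set[OF ab] by auto
  moreover have "d / 6 \<le> \<bar>x - a\<bar> \<and> \<bar>x - a\<bar> < d \<or> d / 6 \<le> \<bar>x - b\<bar> \<and> \<bar>x - b\<bar> < d"
    using length_third_intervals[OF ab] k k' x by auto
  ultimately show ?thesis by blast
qed

subsection \<open>Homeomorphisms between complements of Cantor sets\<close>

lemma topspace_riemann_sphere: "topspace riemann_sphere = UNIV"
  unfolding riemann_sphere_def by (auto simp: UNIV_option_conv)

lemma compact_space_riemann_sphere: "compact_space riemann_sphere"
  by (simp add: riemann_sphere_def)

lemma Hausdorff_space_riemann_sphere: "Hausdorff_space riemann_sphere"
  by (simp add: riemann_sphere_def Hausdorff_space_Alexandroff_compactification locally_compact_space_euclidean)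

lemma openin_riemann_sphere_Some: "openin riemann_sphere (Some ` U) \<longleftrightarrow> open U"
  by (simp add: riemann_sphere_def)

lemma closedin_riemann_sphere_Some: "closedin riemann_sphere (Some ` K) \<longleftrightarrow> compact K"
  by (auto simp: riemann_sphere_def compact_imp_closed)

lemma open_vimage_Some:
  assumes "openin riemann_sphere V"
  shows "open (Some -` V)"
proof -
  have "openin euclidean {x \<in> topspace euclidean. Some x \<in> V}"
    using assms unfolding riemann_sphere_def by (rule openin_continuous_map_preimage[OF continuous_map_Some])
  then show ?thesis by (simp add: vimage_def)
qed

lemma closed_vimage_Some:
  assumes "closedin riemann_sphere V"
  shows "closed (Some -` V)"
proof -
  have "openin riemann_sphere (- V)"
    using assms by (simp add: closedin_def topspace_riemann_sphere Compl_eq_Diff_UNIV)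
  from open_vimage_Some[OF this] show ?thesis
    by (simp add: closed_def vimage_Compl)
qed

lemma sphere_complement_eq: "sphere_complement E = - Some ` complex_of_real ` E"
  by (auto simp: sphere_complement_def topspace_riemann_sphere)

lemma compact_of_real_image:
  assumes "closed E" "E \<subseteq> {0..1}"
  shows "compact (complex_of_real ` E)"
proof -
  have "compact E"
    using assms by (intro compact_eq_bounded_closed[THEN iffD2] conjI bounded_subset[OF bounded_closed_interval])
  then show ?thesis
    by (rule compact_continuous_image[rotated]) (intro continuous_intros)
qed

lemma openin_sphere_complement:
  assumes "closed E" "E \<subseteq> {0..1}"
  shows "openin riemann_sphere (sphere_complement E)"
  using compact_of_real_image[OF assms]
  by (simp add: sphere_complement_def closedin_riemann_sphere_Some openin_diff)

text \<open>The purely topological setting, in which \<open>f\<close> is a homeomorphism of the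
  complements only and is arbitrary on the removed sets.\<close>

locale sphere_homeo =
  fixes E C :: "real set" and f :: "complex option \<Rightarrow> complex option"
  assumes E: "closed E" "E \<subseteq> {0..1}" and C: "closed C" "C \<subseteq> {0..1}"
    and f: "homeomorphic_map (subtopology riemann_sphere (sphere_complement E))
             (subtopology riemann_sphere (sphere_complement C)) f"
begin

abbreviation "X \<equiv> sphere_complement E"
abbreviation "Y \<equiv> sphere_complement C"

text \<open>The finite part of the image: \<open>T\<close> may contain the point at infinity, but an
  image point at infinity is dropped. As \<open>f\<close> is total, \<open>T\<close> is cut down to
  \<open>X\<close>.\<close>

definition planar_image :: "complex option set \<Rightarrow> complex set" where
  "planar_image T = Some -` f ` (T \<inter> X)"

lemma topspace_subtopology_sphere: "topspace (subtopology riemann_sphere T) = T"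
  by (simp add: topspace_riemann_sphere)

lemma inj_on_f: "inj_on f X"
  using homeomorphic_imp_injective_map[OF f] unfolding topspace_subtopology_sphere .

lemma image_f: "f ` X = Y"
  using homeomorphic_imp_surjective_map[OF f] unfolding topspace_subtopology_sphere .

lemma planar_image_mono: "T \<subseteq> U \<Longrightarrow> planar_image T \<subseteq> planar_image U"
  by (auto simp: planar_image_def)

lemma planar_image_Un: "planar_image (T \<union> U) = planar_image T \<union> planar_image U"
  by (auto simp: planar_image_def)

lemma planar_image_disjoint:
  assumes "T \<inter> U = {}"
  shows "planar_image T \<inter> planar_image U = {}"
proof (rule equals0I)
  fix w assume "w \<in> planar_image T \<inter> planar_image U"
  then obtain x y where x: "x \<in> T" "x \<in> X" "Some w = f x" and y: "y \<in> U" "y \<in> X" "Some w = f y"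
    unfolding planar_image_def by blast
  have "x = y"
    by (rule inj_onD[OF inj_on_f _ x(2) y(2)]) (simp flip: x(3) y(3))
  with x(1) y(1) assms show False by blast
qed

lemma planar_image_UNIV: "planar_image UNIV = - complex_of_real ` C"
proof -
  have "planar_image UNIV = Some -` Y"
    unfolding planar_image_def Int_UNIV_left image_f ..
  also have "\<dots> = - complex_of_real ` C"
    unfolding sphere_complement_eq vimage_Compl inj_vimage_image_eq[OF inj_Some] ..
  finally show ?thesis .
qed

lemma open_planar_image:
  assumes "openin riemann_sphere T"
  shows "open (planar_image T)"
proof -
  have "openin (subtopology riemann_sphere X) (T \<inter> X)"
    using assms by (auto simp: openin_subtopology)
  then have "openin (subtopology riemann_sphere Y) (f ` (T \<inter> X))"
    using homeomorphic_imp_open_map[OF f] by (auto simp: open_map_def)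
  then have "openin riemann_sphere (f ` (T \<inter> X))"
    using openin_sphere_complement[OF C] by (simp add: openin_open_subtopology)
  then show ?thesis
    unfolding planar_image_def by (rule open_vimage_Some)
qed

text \<open>Compactness makes the image closed in the plane and not merely relative to the
  complement of \<open>C\<close>.\<close>

lemma closed_planar_image:
  assumes "compact K" "Some ` K \<subseteq> X"
  shows "closed (planar_image (Some ` K))"
proof -
  have "compactin riemann_sphere (Some ` K)"
    using assms(1) closedin_riemann_sphere_Some compact_space_riemann_sphere closedin_compact_space by blast
  then have "compactin (subtopology riemann_sphere X) (Some ` K)"
    using assms(2) by (simp add: compactin_subtopology)
  then have "compactin (subtopology riemann_sphere Y) (f ` Some ` K)"
    using homeomorphic_imp_continuous_map[OF f] by (rule image_compactin)
  then have "closedin riemann_sphere (f ` Some ` K)"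
    using Hausdorff_space_riemann_sphere by (simp add: compactin_subtopology compactin_imp_closedin)
  then show ?thesis
    unfolding planar_image_def using assms(2) by (simp add: Int_absorb2 closed_vimage_Some)
qed

text \<open>
  A relatively closed subset of the source accumulating at a point removed from the source is not
  compact, hence neither is its image.
\<close>

lemma planar_image_accumulates:
  assumes F: "closedin riemann_sphere F" and e: "e \<in> complex_of_real ` E" "e \<in> closure (Some -` (F \<inter> X))"
  shows "complex_of_real ` C \<inter> closure (planar_image F) \<noteq> {}"
proof
  assume disj: "complex_of_real ` C \<inter> closure (planar_image F) = {}"
  let ?K = "f ` (F \<inter> X)"
  have clX: "closedin (subtopology riemann_sphere X) (F \<inter> X)"
    using F by (auto simp: closedin_subtopology)
  then have "closedin (subtopology riemann_sphere Y) ?K"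
    using homeomorphic_imp_closed_map[OF f] by (auto simp: closed_map_def)
  then obtain G where G: "closedin riemann_sphere G" "?K = G \<inter> Y"
    by (auto simp: closedin_subtopology)
  \<comment> \<open>The image is closed relative to \<open>Y\<close>, so a missing limit point would
    lie over \<open>C\<close>, which \<open>disj\<close> excludes.\<close>
  have "riemann_sphere closure_of ?K \<subseteq> ?K"
  proof
    fix y assume y: "y \<in> riemann_sphere closure_of ?K"
    have "y \<in> G"
      using y G closure_of_minimal[of ?K G riemann_sphere] by auto
    moreover have "y \<in> Y"
    proof (rule ccontr)
      assume "y \<notin> Y"
      then obtain w where w: "y = Some w" "w \<in> complex_of_real ` C"
        by (auto simp: sphere_complement_eq)
      have "\<exists>v\<in>planar_image F. dist v w < \<epsilon>" if "0 < \<epsilon>" for \<epsilon>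
      proof -
        have "openin riemann_sphere (Some ` ball w \<epsilon>)" "y \<in> Some ` ball w \<epsilon>"
          using that w by (auto simp: openin_riemann_sphere_Some)
        then obtain z where "z \<in> ?K" "z \<in> Some ` ball w \<epsilon>"
          using y unfolding in_closure_of by blast
        moreover from this(2) obtain v where v: "z = Some v" "v \<in> ball w \<epsilon>" by (rule imageE)
        ultimately have "Some v \<in> ?K" by simp
        with v(2) show ?thesis
          unfolding planar_image_def by (intro bexI[of _ v]) (simp_all add: dist_commute)
      qed
      then have "w \<in> closure (planar_image F)"
        by (simp add: closure_approachable)
      with w disj show False by auto
    qed
    ultimately show "y \<in> ?K" using G(2) by auto
  qed
  then have "closedin riemann_sphere ?K"
    using closure_of_subset_eq[of ?K riemann_sphere] by (simp add: topspace_riemann_sphere)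
  then have "compactin riemann_sphere ?K"
    using compact_space_riemann_sphere closedin_compact_space by blast
  then have K: "compactin (subtopology riemann_sphere Y) ?K"
    using G(2) by (simp add: compactin_subtopology)
  \<comment> \<open>The inverse carries compactness back to \<open>F \<inter> X\<close>, which would
    then be closed and contain the removed point over \<open>e\<close>.\<close>
  obtain g where g: "homeomorphic_maps (subtopology riemann_sphere X) (subtopology riemann_sphere Y) f g"
    using f by (auto simp: homeomorphic_map_maps)
  then have "continuous_map (subtopology riemann_sphere Y) (subtopology riemann_sphere X) g"
    by (simp add: homeomorphic_maps_def)
  with K have "compactin (subtopology riemann_sphere X) (g ` ?K)"
    by (rule image_compactin)
  moreover have "g ` ?K = F \<inter> X"
  proof -
    have "\<forall>x\<in>X. g (f x) = x"
      using g unfolding homeomorphic_maps_def topspace_subtopology_sphere by blast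
    then show ?thesis by (simp add: image_image)
  qed
  ultimately have "closedin riemann_sphere (F \<inter> X)"
    using Hausdorff_space_riemann_sphere by (simp add: compactin_subtopology compactin_imp_closedin)
  then have "closed (Some -` (F \<inter> X))"
    by (rule closed_vimage_Some)
  with e(2) have "Some e \<in> X"
    by (simp add: closure_closed)
  with e(1) show False
    by (auto simp: sphere_complement_eq)
qed

end

section \<open>Separation of the target set by the images of the squares\<close>

lemma continuous_sq_norm: "continuous_on A sq_norm"
  unfolding sq_norm_def by (intro continuous_intros)

lemma compact_sq_norm_le: "compact {z. sq_norm z \<le> r}"
proof -
  have "{z. sq_norm z \<le> r} = cbox (Complex (- r) (- r)) (Complex r r)"
    by (auto simp: sq_norm_def in_cbox_complex_iff abs_le_iff)
  then show ?thesis by simp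
qed

lemma open_sq_norm_less: "open {z. sq_norm z < r}"
  using open_Collect_less[OF continuous_sq_norm continuous_on_const, of r] by simp

lemma sq_norm_of_real: "sq_norm (of_real x) = \<bar>x\<bar>"
  by (simp add: sq_norm_def)

text \<open>The non-real points of \<open>U\<close> are dense in it. This makes \<open>0\<close> and
  \<open>1\<close> limit points of the two sides of the annulus in \<open>X\<close>, whatever else
  \<open>E\<close> contains nearby.\<close>

lemma real_in_closure_nonreal:
  assumes "open U" "of_real x \<in> U" "- range complex_of_real \<inter> U \<subseteq> A"
  shows "complex_of_real x \<in> closure A"
proof (rule ccontr)
  assume "complex_of_real x \<notin> closure A"
  then have "U - closure A \<noteq> {}" "open (U - closure A)"
    using assms by auto
  from open_diff_real_nonempty[OF this(2,1), of UNIV] show False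
    using assms(3) closure_subset[of A] by blast
qed

context sphere_homeo
begin

text \<open>The pieces are the limit sets of the images \<open>P\<close> and \<open>Q\<close> of the
  parts inside and outside the annulus, hence independent of \<open>r\<close>. The two sides
  \<open>A r\<close> and \<open>B r\<close> of every square contain \<open>P\<close> and
  \<open>Q\<close>, so their closures contain the pieces.\<close>

lemma separation:
  assumes gap: "\<And>x y. x < y \<Longrightarrow> \<exists>z. x < z \<and> z < y \<and> z \<notin> C"
    and "0 \<in> E" "1 \<in> E" and t: "0 < t1" "t1 < t2" "t2 < 1" "\<And>x. x \<in> E \<Longrightarrow> x < t1 \<or> t2 < x"
  obtains C1 C2 where "closed C1" "closed C2" "C1 \<union> C2 = complex_of_real ` C" "C1 \<inter> C2 = {}"
    "C1 \<noteq> {}" "C2 \<noteq> {}"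
    "\<forall>r\<in>{t1<..<t2}. \<exists>A B. open A \<and> open B \<and> A \<inter> B = {} \<and>
        - complex_of_real ` C \<subseteq> A \<union> B \<union> planar_image (Some ` {z. sq_norm z = r}) \<and>
        C1 \<subseteq> closure A \<and> C2 \<subseteq> closure B"
proof -
  let ?C = "complex_of_real ` C"
  have clC: "closed ?C" using compact_of_real_image[OF C] by (rule compact_imp_closed)
  define P where "P = planar_image (Some ` {z. sq_norm z \<le> t1})"
  define Q where "Q = planar_image (- Some ` {z. sq_norm z < t2})"
  define M where "M = planar_image (Some ` {z. t1 \<le> sq_norm z \<and> sq_norm z \<le> t2})"
  define C1 where "C1 = ?C \<inter> closure P"
  define C2 where "C2 = ?C \<inter> closure Q"
  define A where "A r = planar_image (Some ` {z. sq_norm z < r})" for r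
  define B where "B r = planar_image (- Some ` {z. sq_norm z \<le> r})" for r
  have inX: "Some z \<in> X" if "t1 \<le> sq_norm z" "sq_norm z \<le> t2" for z
    using that t(4) E(2) by (force simp: sphere_complement_eq sq_norm_of_real)
  have opA: "open (A r)" for r
    unfolding A_def by (intro open_planar_image) (simp add: openin_riemann_sphere_Some open_sq_norm_less)
  have opB: "open (B r)" for r
  proof -
    have "openin riemann_sphere (- Some ` {z. sq_norm z \<le> r})"
      using closedin_riemann_sphere_Some compact_sq_norm_le
      by (metis Compl_eq_Diff_UNIV closedin_def topspace_riemann_sphere)
    then show ?thesis unfolding B_def by (rule open_planar_image)
  qed
  have AB: "A r \<inter> B r = {}" for r
    unfolding A_def B_def by (rule planar_image_disjoint) auto
  have cov: "- ?C \<subseteq> A r \<union> B r \<union> planar_image (Some ` {z. sq_norm z = r})" for r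
  proof -
    have "UNIV = Some ` {z. sq_norm z < r} \<union> - Some ` {z. sq_norm z \<le> r} \<union> Some ` {z. sq_norm z = r}"
      by force
    then show ?thesis
      unfolding planar_image_UNIV[symmetric] A_def B_def planar_image_Un[symmetric] by (metis order_refl)
  qed
  have PA: "P \<subseteq> A r" and QB: "Q \<subseteq> B r" if "t1 < r" "r < t2" for r
    unfolding P_def A_def Q_def B_def using that by (auto intro!: planar_image_mono)
  have PQM: "- ?C \<subseteq> P \<union> Q \<union> M"
  proof -
    have "UNIV = Some ` {z. sq_norm z \<le> t1} \<union> - Some ` {z. sq_norm z < t2} \<union> Some ` {z. t1 \<le> sq_norm z \<and> sq_norm z \<le> t2}"
      by force
    then show ?thesis
      unfolding planar_image_UNIV[symmetric] P_def Q_def M_def planar_image_Un[symmetric] by (metis order_refl)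
  qed
  have clM: "closed M"
    unfolding M_def
  proof (rule closed_planar_image)
    have "closed {z. t1 \<le> sq_norm z}"
      by (intro closed_Collect_le continuous_sq_norm continuous_on_const)
    then have "compact ({z. sq_norm z \<le> t2} \<inter> {z. t1 \<le> sq_norm z})"
      by (rule compact_Int_closed[OF compact_sq_norm_le])
    also have "{z. sq_norm z \<le> t2} \<inter> {z. t1 \<le> sq_norm z} = {z. t1 \<le> sq_norm z \<and> sq_norm z \<le> t2}" by auto
    finally show "compact {z. t1 \<le> sq_norm z \<and> sq_norm z \<le> t2}" .
  qed (use inX in auto)
  have MC: "M \<inter> ?C = {}"
    using planar_image_mono[of _ UNIV] planar_image_UNIV unfolding M_def by blast
  \<comment> \<open>For this one radius, \<open>A r\<close> and \<open>B r\<close> serve as disjoint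
    open neighbourhoods of \<open>P\<close> and \<open>Q\<close>.\<close>
  define r where "r = (t1 + t2) / 2"
  have r: "t1 < r" "r < t2" using t by (auto simp: r_def)
  have C1A: "C1 \<subseteq> closure (A s)" and C2B: "C2 \<subseteq> closure (B s)" if "t1 < s" "s < t2" for s
    using closure_mono[OF PA[OF that]] closure_mono[OF QB[OF that]] by (auto simp: C1_def C2_def)
  \<comment> \<open>Near \<open>w\<close> the image \<open>M\<close> of the annulus is absent. So
    \<open>w\<close> is a limit point of \<open>P\<close> or of \<open>Q\<close>, and not of both,
    since a small disc minus the set is connected.\<close>
  have local: "w \<in> closure P \<longleftrightarrow> w \<notin> closure Q" if w: "w \<in> ?C" for w
  proof -
    have "w \<in> - M" "open (- M)" using w MC clM by auto
    then obtain \<epsilon> where e: "0 < \<epsilon>" "ball w \<epsilon> \<subseteq> - M" using open_contains_ball by blast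
    let ?V = "ball w \<epsilon>"
    have V: "?V - ?C \<subseteq> P \<union> Q" using PQM e by blast
    then have V': "?V - ?C \<subseteq> A r \<union> B r" using PA[OF r] QB[OF r] by blast
    have "w \<in> closure (?V - ?C)"
    proof (rule ccontr)
      assume "w \<notin> closure (?V - ?C)"
      then have "w \<in> ?V - closure (?V - ?C)"
        using e(1) by simp
      then have ne: "?V - closure (?V - ?C) \<noteq> {}"
        by (metis empty_iff)
      have "open (?V - closure (?V - ?C))"
        by (rule open_Diff[OF open_ball closed_closure])
      from open_diff_real_nonempty[OF this ne, of C]
      obtain v where "v \<in> ?V - ?C" "v \<notin> closure (?V - ?C)" by blast
      then show False
        using subsetD[OF closure_subset] by metis
    qed
    also have "closure (?V - ?C) \<subseteq> closure P \<union> closure Q"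
      using closure_mono[OF V] by simp
    finally have "w \<in> closure P \<or> w \<in> closure Q" by simp
    moreover have False if "w \<in> closure P" "w \<in> closure Q"
    proof (rule not_separated[OF C(1) gap open_ball connected_ball opA opB AB V'])
      have "w \<in> ?V" using e by simp
      then show "?V \<inter> closure (A r) \<noteq> {}" "?V \<inter> closure (B r) \<noteq> {}"
        using that closure_mono[OF PA[OF r]] closure_mono[OF QB[OF r]] by blast+
    qed
    ultimately show ?thesis by blast
  qed
  have ne1: "C1 \<noteq> {}"
    unfolding C1_def P_def
  proof (rule planar_image_accumulates)
    show "closedin riemann_sphere (Some ` {z. sq_norm z \<le> t1})"
      by (simp add: closedin_riemann_sphere_Some compact_sq_norm_le)
    show "complex_of_real 0 \<in> complex_of_real ` E" using assms(2) by blast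
    show "complex_of_real 0 \<in> closure (Some -` (Some ` {z. sq_norm z \<le> t1} \<inter> X))"
      by (rule real_in_closure_nonreal[OF open_sq_norm_less[of t1]])
         (use t in \<open>auto simp: sphere_complement_eq sq_norm_def\<close>)
  qed
  \<comment> \<open>Since \<open>t2 < 1\<close>, the point \<open>1\<close> of \<open>E\<close> lies
    outside the annulus, just as \<open>0\<close> lies inside.\<close>
  have ne2: "C2 \<noteq> {}"
    unfolding C2_def Q_def
  proof (rule planar_image_accumulates)
    have "openin riemann_sphere (Some ` {z. sq_norm z < t2})"
      by (simp add: openin_riemann_sphere_Some open_sq_norm_less)
    then show "closedin riemann_sphere (- Some ` {z. sq_norm z < t2})"
      by (simp add: closedin_def topspace_riemann_sphere Compl_eq_Diff_UNIV[symmetric])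
    show "complex_of_real 1 \<in> complex_of_real ` E" using assms(3) by blast
    have "open {z. t2 < sq_norm z}"
      by (intro open_Collect_less continuous_sq_norm continuous_on_const)
    then show "complex_of_real 1 \<in> closure (Some -` (- Some ` {z. sq_norm z < t2} \<inter> X))"
      by (rule real_in_closure_nonreal) (use t in \<open>auto simp: sphere_complement_eq sq_norm_def\<close>)
  qed
  have cl: "closed C1" "closed C2"
    unfolding C1_def C2_def by (intro closed_Int clC closed_closure)+
  have un: "C1 \<union> C2 = ?C" "C1 \<inter> C2 = {}"
    unfolding C1_def C2_def using local by blast+
  have "\<forall>s\<in>{t1<..<t2}. \<exists>A B. open A \<and> open B \<and> A \<inter> B = {} \<and>
        - ?C \<subseteq> A \<union> B \<union> planar_image (Some ` {z. sq_norm z = s}) \<and>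
        C1 \<subseteq> closure A \<and> C2 \<subseteq> closure B"
  proof (rule ballI, intro exI conjI)
    fix s assume s: "s \<in> {t1<..<t2}"
    show "open (A s)" "open (B s)" "A s \<inter> B s = {}" by (rule opA opB AB)+
    show "- ?C \<subseteq> A s \<union> B s \<union> planar_image (Some ` {z. sq_norm z = s})" by (rule cov)
    show "C1 \<subseteq> closure (A s)" "C2 \<subseteq> closure (B s)" using s by (simp_all add: C1A C2B)
  qed
  with cl un ne1 ne2 show ?thesis by (rule that)
qed

end

section \<open>Comparison of the moduli and conclusion\<close>

text \<open>The logarithm is that of the ratio \<open>t2 / t1\<close> of the radii, and
  \<open>q n > 1 / 2\<close> says exactly that \<open>t1 < t2\<close>.\<close>

lemma quasiconformal_imp_ratio_le:
  fixes q :: "nat \<Rightarrow> real"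
  assumes q: "\<And>n. n \<ge> 1 \<Longrightarrow> 0 < q n \<and> q n < 1"
    and qf: "quasiconformal_homeo K (sphere_complement (random_cantor_set q))
              (sphere_complement middle_third_cantor_set) f"
    and n: "1 \<le> n" "q n > 1 / 2"
  shows "ln (1 / (2 * (1 - q n))) \<le> 173056 * K"
proof -
  interpret q: cantor_ratios q
    by unfold_locales (rule q)
  let ?E = "random_cantor_set q" and ?C = middle_third_cantor_set
  interpret sphere_homeo ?E ?C f
  proof
    show "closed ?E" "?E \<subseteq> {0..1}"
      by (rule q.closed_random_cantor_set q.random_cantor_set_subset_unit)+
    show "closed ?C" "?C \<subseteq> {0..1}"
      unfolding middle_third_cantor_set_def
      by (rule third.closed_random_cantor_set third.random_cantor_set_subset_unit)+
    show "homeomorphic_map (subtopology riemann_sphere (sphere_complement ?E))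
        (subtopology riemann_sphere (sphere_complement ?C)) f"
      using qf unfolding quasiconformal_homeo_def by (rule conjunct1)
  qed
  define D where "D = coord_domain Some Some X f"
  define g where "g = coord_map Some Some f"
  have qc: "plane_quasiconformal K D g"
    using qf by (simp add: quasiconformal_homeo_def sphere_params_def D_def g_def)
  obtain k where k: "n = Suc k" using n(1) by (cases n) auto
  \<comment> \<open>Doubling the length keeps the closed annulus strictly off \<open>E\<close>, at
    the price of a constant factor in \<open>t2 / t1\<close>.\<close>
  define t1 where "t1 = 2 * q.first_length n"
  define t2 where "t2 = q.first_length k / 2"
  have qn: "0 < 1 - q n" "1 - q n < 1 / 2" using q[OF n(1)] n(2) by auto
  have t1: "t1 = q.first_length k * (1 - q n)"
    by (simp add: t1_def k q.first_length_Suc)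
  have ratio: "t2 / t1 = 1 / (2 * (1 - q n))"
    using q.first_length_pos[of k] by (simp add: t1 t2_def)
  have t: "0 < t1" "t1 < t2" "t2 < 1"
    using q.first_length_pos[of k] q.first_length_le_1[of k] qn by (auto simp: t1 t2_def)
  have gapE: "x < t1 \<or> t2 < x" if "x \<in> ?E" for x
  proof (cases "q.first_length n < x")
    case True
    then show ?thesis
      using q.random_cantor_set_gap[OF that, of k] by (simp add: t2_def k)
  next
    case False
    then show ?thesis
      using q.first_length_pos[of n] by (simp add: t1_def)
  qed
  obtain C1 C2 where C12: "closed C1" "closed C2" "C1 \<union> C2 = complex_of_real ` ?C" "C1 \<inter> C2 = {}"
      "C1 \<noteq> {}" "C2 \<noteq> {}"
    and sep: "\<forall>r\<in>{t1<..<t2}. \<exists>A B. open A \<and> open B \<and> A \<inter> B = {} \<and>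
        - complex_of_real ` ?C \<subseteq> A \<union> B \<union> planar_image (Some ` {z. sq_norm z = r}) \<and>
        C1 \<subseteq> closure A \<and> C2 \<subseteq> closure B"
    by (rule separation[OF middle_third_cantor_set_gap q.zero_one_in_random_cantor_set t gapE])
  \<comment> \<open>The geometric mean cuts the annulus into two of equal logarithmic width.\<close>
  define m where "m = sqrt (t1 * t2)"
  have m: "t1 < m" "m < t2"
  proof -
    show "t1 < m"
      unfolding m_def by (rule real_less_rsqrt) (use t in \<open>simp add: power2_eq_square\<close>)
    show "m < t2"
      unfolding m_def by (rule real_less_lsqrt) (use t in \<open>simp_all add: power2_eq_square\<close>)
  qed
  have lnm: "ln m = (ln t1 + ln t2) / 2"
    using t by (simp add: m_def ln_sqrt ln_mult)
  \<comment> \<open>\<open>c\<close> is the radius of the only square that can pass through the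
    preimage of infinity; it is set to \<open>0\<close>, an arbitrary value, if no finite point is
    mapped there.\<close>
  obtain c where c: "\<And>z. Some z \<in> X \<Longrightarrow> f (Some z) = None \<Longrightarrow> sq_norm z = c"
  proof (cases "\<exists>z. Some z \<in> X \<and> f (Some z) = None")
    case True
    then obtain z0 where z0: "Some z0 \<in> X" "f (Some z0) = None" by blast
    show ?thesis
    proof (rule that[of "sq_norm z0"])
      fix z assume z: "Some z \<in> X" "f (Some z) = None"
      have "Some z = Some z0"
        by (rule inj_onD[OF inj_on_f _ z(1) z0(1)]) (simp add: z(2) z0(2))
      then show "sq_norm z = sq_norm z0" by simp
    qed
  next
    case False
    then show ?thesis using that[of 0] by blast
  qed
  (* The point mapped to infinity is missing from the chart, so keep only a half of the annulus
     that does not contain it. *)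
  obtain s1 s2 where s: "t1 \<le> s1" "s1 < s2" "s2 \<le> t2" "c \<notin> {s1<..<s2}" "ln (s2 / s1) = ln (t2 / t1) / 2"
  proof (cases "c \<le> m")
    case True
    have "ln (t2 / m) = ln (t2 / t1) / 2"
      using m t lnm by (simp add: ln_div)
    with True m show ?thesis by (intro that[of m t2]) auto
  next
    case False
    have "ln (m / t1) = ln (t2 / t1) / 2"
      using m t lnm by (simp add: ln_div)
    with False m show ?thesis by (intro that[of t1 m]) auto
  qed
  let ?\<Gamma> = "square_path ` {s1<..<s2}"
  have img: "path_image (square_path r) = {z. sq_norm z = r}" if "r \<in> {s1<..<s2}" for r
    using that s t by (intro path_image_square_path) auto
  have inD: "path_image (square_path r) \<subseteq> D" if r: "r \<in> {s1<..<s2}" for r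
  proof
    fix z assume "z \<in> path_image (square_path r)"
    then have z: "sq_norm z = r" using img[OF r] by simp
    have "z \<noteq> of_real x" if "x \<in> ?E" for x
    proof
      assume "z = of_real x"
      with z have "x = r" using subsetD[OF E(2) that] by (simp add: sq_norm_of_real)
      with gapE[OF that] r s show False by auto
    qed
    then have zX: "Some z \<in> X" by (auto simp: sphere_complement_eq)
    have "f (Some z) \<noteq> None" using c[OF zX] z r s(4) by blast
    then have "f (Some z) \<in> range Some" by (cases "f (Some z)") auto
    with zX show "z \<in> D" by (simp add: D_def coord_domain_def)
  qed
  have "curve_modulus ((\<circ>) g ` ?\<Gamma>) \<le> 2704"
  proof (rule curve_modulus_separating_le[OF C(1) middle_third_cantor_set_gap C(2)
        middle_third_cantor_set_uniformly_perfect C12])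
    fix \<gamma> assume "\<gamma> \<in> (\<circ>) g ` ?\<Gamma>"
    then obtain r where r: "r \<in> {s1<..<s2}" and \<gamma>: "\<gamma> = g \<circ> square_path r" by auto
    have "continuous_on (path_image (square_path r)) g"
      using qc inD[OF r] by (auto simp: plane_quasiconformal_def intro: continuous_on_subset)
    then have "path \<gamma>"
      unfolding \<gamma> by (intro path_continuous_image path_square_path)
    \<comment> \<open>\<open>sep\<close> speaks of the image of the square as a set; this inclusion
      transfers it to the curve.\<close>
    have sub: "planar_image (Some ` {z. sq_norm z = r}) \<subseteq> path_image \<gamma>"
    proof
      fix w assume "w \<in> planar_image (Some ` {z. sq_norm z = r})"
      then obtain z where z: "sq_norm z = r" "Some w = f (Some z)" by (auto simp: planar_image_def)
      have "inv Some (Some w) = w" by (rule inv_f_f) simp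
      then have "w = g z" by (simp add: g_def coord_map_def flip: z(2))
      then show "w \<in> path_image \<gamma>"
        using z(1) img[OF r] by (simp add: \<gamma> path_image_compose)
    qed
    have "r \<in> {t1<..<t2}" using r s by auto
    from bspec[OF sep this]
    obtain A B where AB: "open A" "open B" "A \<inter> B = {}"
        "- complex_of_real ` ?C \<subseteq> A \<union> B \<union> planar_image (Some ` {z. sq_norm z = r})"
        "C1 \<subseteq> closure A" "C2 \<subseteq> closure B"
      by (elim exE conjE)
    have "- complex_of_real ` ?C \<subseteq> A \<union> B \<union> path_image \<gamma>"
      by (rule order_trans[OF AB(4) Un_mono[OF order_refl sub]])
    with AB(1-3,5,6) \<open>path \<gamma>\<close> show "path \<gamma> \<and> (\<exists>A B. open A \<and> open B \<and> A \<inter> B = {} \<and>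
        - complex_of_real ` ?C \<subseteq> A \<union> B \<union> path_image \<gamma> \<and> C1 \<subseteq> closure A \<and> C2 \<subseteq> closure B)"
      by (intro conjI exI[of _ A] exI[of _ B])
  qed
  have K: "1 \<le> K" using qc by (simp add: plane_quasiconformal_def)
  have "ennreal (ln (s2 / s1) / 32) \<le> curve_modulus ?\<Gamma>"
    using s t by (intro curve_modulus_square_paths_ge) auto
  also have "\<dots> \<le> ennreal K * curve_modulus ((\<circ>) g ` ?\<Gamma>)"
  proof -
    have "?\<Gamma> \<subseteq> {\<gamma>. path \<gamma> \<and> path_image \<gamma> \<subseteq> D}"
      using inD path_square_path by blast
    with qc show ?thesis unfolding plane_quasiconformal_def by simp
  qed
  also have "\<dots> \<le> ennreal K * 2704"
    by (intro mult_left_mono) (use \<open>curve_modulus ((\<circ>) g ` ?\<Gamma>) \<le> 2704\<close> in auto)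
  also have "\<dots> = ennreal (K * 2704)"
    using K by (simp add: ennreal_mult)
  finally have "ln (s2 / s1) / 32 \<le> K * 2704"
    using K by (simp add: ennreal_le_iff)
  then show ?thesis
    unfolding ratio[symmetric] using s(5) by simp
qed

theorem theorem3:
  fixes q :: "nat \<Rightarrow> real"
  assumes "\<And>n. n \<ge> 1 \<Longrightarrow> 0 < q n \<and> q n < 1"
    and "\<not> (\<exists>\<delta>>0. \<forall>n\<ge>1. q n \<le> 1 - \<delta>)"
  shows "\<not> quasiconformally_equivalent
            (sphere_complement (random_cantor_set q))
            (sphere_complement middle_third_cantor_set)"
proof
  assume "quasiconformally_equivalent (sphere_complement (random_cantor_set q))
            (sphere_complement middle_third_cantor_set)"
  then obtain K f where f: "quasiconformal_homeo K (sphere_complement (random_cantor_set q))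
              (sphere_complement middle_third_cantor_set) f"
    by (auto simp: quasiconformally_equivalent_def)
  \<comment> \<open>Once \<open>2 * (1 - q n)\<close> is below \<open>c\<close>, the logarithmic
    bound fails; the minimum with \<open>1 / 2\<close> in \<open>m\<close> ensures
    \<open>q n > 1 / 2\<close>.\<close>
  define c where "c = exp (- (173056 * K))"
  define m where "m = min (1 / 2) (c / 2)"
  have m: "0 < m" "m \<le> 1 / 2" "m \<le> c / 2" by (simp_all add: m_def c_def)
  with assms(2) obtain n where n: "1 \<le> n" "\<not> q n \<le> 1 - m" by blast
  have "1 / 2 < q n" using n(2) m by linarith
  have "1 - q n < c / 2" using n(2) m by linarith
  then have "2 * (1 - q n) < c" by simp
  then have lt: "2 * (1 - q n) < exp (- (173056 * K))" by (simp only: c_def)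
  have "0 < 1 - q n" using assms(1)[OF n(1)] by simp
  have "ln (2 * (1 - q n)) < - (173056 * K)"
    using lt \<open>0 < 1 - q n\<close> by (metis exp_gt_zero ln_exp ln_less_cancel_iff mult_pos_pos zero_less_numeral)
  moreover have "ln (1 / (2 * (1 - q n))) = - ln (2 * (1 - q n))"
    using \<open>0 < 1 - q n\<close> by (simp add: ln_div)
  ultimately show False
    using quasiconformal_imp_ratio_le[OF assms(1) f n(1) \<open>1 / 2 < q n\<close>] by simp
qed

end
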